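(* For every integer $r \geqslant 1$, there exists a constant $d_r \geqslant 0$ such that for every integer $n \geqslant 1$, $$\mathsf{D}(C^r_n) \leqslant r(n-1) + 1 + d_r\left(\frac{n}{P(n)}-1\right).$$
   Context: For an integer $n \geqslant 1$, $C_n$ denotes the cyclic group of order $n$ and $C_n^r$ the direct sum of $r$ copies of $C_n$. For a finite Abelian group $G$, a sequence over $G$ is a finite (unordered, repetitions allowed) sequence of elements of $G$; it is zero-sum if the sum of its elements is $0$. The Davenport constant $\mathsf{D}(G)$ is the smallest integer $t \geqslant 1$ such that every sequence over $G$ of length at least $t$ contains a non-empty zero-sum subsequence. For an integer $n \geqslant 1$, $P(n)$ denotes the greatest prime power dividing $n$, with the convention $P(1)=1$. *)

theory Defs
  imports
    Complex_Main
    "HOL-Library.Multiset"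
    "HOL-Algebra.Multiplicative_Group"
    "HOL-Algebra.Product_Groups"
    "HOL-Number_Theory.Prime_Powers"
begin

definition cyclic_power :: "nat \<Rightarrow> nat \<Rightarrow> (nat \<Rightarrow> int) monoid" where
  "cyclic_power n r = product_group {..<r} (\<lambda>_. integer_mod_group n)"

text \<open>
  Sequences over a group are multisets of elements of its carrier. HOL-Algebra writes groups
  multiplicatively, so the sum of the terms of a sequence (with repetition) is a product.
\<close>

definition seq_sum :: "('a, 'b) monoid_scheme \<Rightarrow> 'a multiset \<Rightarrow> 'a" where
  "seq_sum G S = finprod G (\<lambda>x. x [^]\<^bsub>G\<^esub> count S x) (set_mset S)"

definition zero_sum :: "('a, 'b) monoid_scheme \<Rightarrow> 'a multiset \<Rightarrow> bool" where
  "zero_sum G S \<longleftrightarrow> seq_sum G S = \<one>\<^bsub>G\<^esub>"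

definition forces_zero_sum :: "('a, 'b) monoid_scheme \<Rightarrow> nat \<Rightarrow> bool" where
  "forces_zero_sum G t \<longleftrightarrow>
     (\<forall>S. set_mset S \<subseteq> carrier G \<and> size S \<ge> t \<longrightarrow>
        (\<exists>T. T \<subseteq># S \<and> T \<noteq> {#} \<and> zero_sum G T))"

definition davenport :: "('a, 'b) monoid_scheme \<Rightarrow> nat" where
  "davenport G = (LEAST t. t \<ge> 1 \<and> forces_zero_sum G t)"

definition greatest_primepow :: "nat \<Rightarrow> nat" where
  "greatest_primepow n = (if n = 1 then 1 else Max {q. primepow q \<and> q dvd n})"

lemma comm_group_cyclic_power: "comm_group (cyclic_power n r)"
proof (rule group.group_comm_groupI)
  show "group (cyclic_power n r)"
    by (simp add: cyclic_power_def)
  show "x \<otimes>\<^bsub>cyclic_power n r\<^esub> y = y \<otimes>\<^bsub>cyclic_power n r\<^esub> x" for x y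
    by (simp add: cyclic_power_def add.commute)
qed

lemma finite_carrier_cyclic_power: "n \<ge> 1 \<Longrightarrow> finite (carrier (cyclic_power n r))"
  by (auto simp: cyclic_power_def carrier_integer_mod_group intro!: finite_PiE)

lemma card_carrier_cyclic_power: "n \<ge> 1 \<Longrightarrow> card (carrier (cyclic_power n r)) = n ^ r"
  by (simp add: cyclic_power_def carrier_integer_mod_group card_PiE)

lemma seq_sum_empty: "comm_group G \<Longrightarrow> seq_sum G {#} = \<one>\<^bsub>G\<^esub>"
  by (simp add: seq_sum_def comm_group.axioms(1) comm_monoid.finprod_empty)

lemma seq_sum_add_mset:
  assumes "comm_group G" "set_mset S \<subseteq> carrier G" "x \<in> carrier G"
  shows "seq_sum G (add_mset x S) = x \<otimes>\<^bsub>G\<^esub> seq_sum G S"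
proof -
  interpret comm_group G by fact
  define A where "A = set_mset S - {x}"
  have A: "finite A" "x \<notin> A" "A \<subseteq> carrier G"
    using assms by (auto simp: A_def)
  have split: "seq_sum G T = x [^]\<^bsub>G\<^esub> count T x \<otimes>\<^bsub>G\<^esub> finprod G (\<lambda>y. y [^]\<^bsub>G\<^esub> count T y) A"
    if "set_mset T - {x} = A" for T
  proof (cases "x \<in># T")
    case True
    then have "set_mset T = insert x A" using that by auto
    then show ?thesis
      using A assms(3) by (auto simp: seq_sum_def intro!: finprod_insert)
  next
    case False
    then have "set_mset T = A" "count T x = 0" using that by (auto simp: count_eq_zero_iff)
    moreover have "finprod G (\<lambda>y. y [^]\<^bsub>G\<^esub> count T y) A \<in> carrier G"
      using A by (auto intro!: finprod_closed)
    ultimately show ?thesis by (simp add: seq_sum_def)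
  qed
  have "finprod G (\<lambda>y. y [^]\<^bsub>G\<^esub> count (add_mset x S) y) A = finprod G (\<lambda>y. y [^]\<^bsub>G\<^esub> count S y) A"
    using A by (intro finprod_cong') auto
  moreover have "finprod G (\<lambda>y. y [^]\<^bsub>G\<^esub> count S y) A \<in> carrier G"
    using A by (auto intro!: finprod_closed)
  moreover have "set_mset (add_mset x S) - {x} = A" "set_mset S - {x} = A"
    by (auto simp: A_def)
  ultimately show ?thesis
    using assms(3) by (simp add: split nat_pow_Suc2 m_ac del: nat_pow_Suc)
qed

text \<open>The minimum defining the Davenport constant of a finite abelian group is attained.\<close>

lemma davenport_exists:
  assumes "comm_group G" "finite (carrier G)"
  shows "\<exists>t\<ge>1. forces_zero_sum G t"
proof -
  interpret comm_group G by fact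
  define N where "N = card (carrier G)"
  have N: "N > 0" using assms(2) one_closed by (auto simp: N_def card_gt_0_iff)
  have "\<exists>T. T \<subseteq># S \<and> T \<noteq> {#} \<and> zero_sum G T"
    if S: "set_mset S \<subseteq> carrier G" "size S \<ge> N * N" for S
  proof -
    have "\<exists>x\<in>set_mset S. count S x \<ge> N"
    proof (rule ccontr)
      assume "\<not> ?thesis"
      then have lt: "\<And>x. x \<in># S \<Longrightarrow> count S x < N" by force
      have "S \<noteq> {#}" using S(2) N by auto
      then have "size S < (\<Sum>x\<in>set_mset S. N)"
        unfolding size_multiset_overloaded_eq using lt by (intro sum_strict_mono) auto
      also have "\<dots> \<le> N * N"
        using card_mono[OF assms(2) S(1)] by (simp add: N_def)
      finally show False using S(2) by simp
    qed
    then obtain x where x: "x \<in># S" "count S x \<ge> N" by blast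
    then have xc: "x \<in> carrier G" using S by auto
    have "zero_sum G (replicate_mset N x)"
      using N xc pow_order_eq_1[OF xc] by (simp add: zero_sum_def seq_sum_def order_def N_def)
    then show ?thesis
      using x N by (intro exI[of _ "replicate_mset N x"]) (auto simp: count_le_replicate_mset_subset_eq)
  qed
  then show ?thesis
    using N by (intro exI[of _ "N * N"]) (auto simp: forces_zero_sum_def)
qed

end

theory Submission
  imports Defs "HOL-Number_Theory.Cong" "HOL-Library.Disjoint_Sets"
begin

text \<open>
  Write \<open>n = m q\<close> with \<open>q = P(n)\<close> a power of a prime. From a sequence over \<open>C\<^sub>n\<^sup>r\<close> one extracts
  greedily disjoint blocks of length at most \<open>m\<close> with sum zero modulo \<open>m\<close>; dividing the block sums
  by \<open>m\<close> gives a sequence over \<open>C\<^sub>q\<^sup>r\<close>, for which Olson's bound \<open>r (q - 1) + 1\<close> suffices. The blocks cost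
  \<open>m r (q - 1)\<close> terms, and the extraction works as long as \<open>C (m - 1) + 1\<close> terms remain.

  Olson's bound: modulo \<open>p\<close>, a product of \<open>r\<close> binomial coefficients of degree \<open>q - 1\<close> is the indicator
  of zero sums, and the alternating sum of a polynomial of degree below \<open>card A\<close> over the subsets
  of \<open>A\<close> vanishes.

  The existence of short blocks reduces multiplicatively to a prime modulus \<open>p\<close>, where the argument of
  Alon and Dubiner gives \<open>p\<close> terms with sum zero among any \<open>C p\<close> terms. If an affine hyperplane
  contains many terms, one inducts on the dimension. Otherwise one picks disjoint pairs of terms
  one after the other and follows the set \<open>Y\<close> of sums of exactly half of the chosen terms: a pair
  \<open>(i, j)\<close> enlarges \<open>Y\<close> at least by the number of points moved out of \<open>Y\<close> by the translation by
  \<open>g j - g i\<close>. When two such sets fill more than half of the space each, their sumset is everything.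
\<close>

section \<open>Olson's theorem for prime powers\<close>

text \<open>Pairing each \<open>I\<close> without \<open>x\<close> with \<open>insert x I\<close>
  leaves an alternating sum of finite differences. Such a difference is a combination of products
  over proper subsets \<open>U\<close> of \<open>T\<close>, with coefficients independent of
  \<open>I\<close>, so the induction hypothesis kills every term.\<close>

lemma alternating_sum_prod_affine:
  fixes a :: "'t \<Rightarrow> 'i \<Rightarrow> 'a::comm_ring_1" and b :: "'t \<Rightarrow> 'a"
  assumes "finite A" "finite T" "card T < card A"
  shows "(\<Sum>I\<in>Pow A. (-1) ^ card I * (\<Prod>t\<in>T. b t + (\<Sum>i\<in>I. a t i))) = 0"
  using assms
proof (induction A arbitrary: T rule: finite_induct)
  case empty
  then show ?case by simp
next
  case (insert x A)
  define L where "L I t = b t + (\<Sum>i\<in>I. a t i)" for I t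
  have fin: "finite I" "x \<notin> I" if "I \<in> Pow A" for I
    using that insert.hyps by (auto intro: finite_subset)
  have diff: "(\<Prod>t\<in>T. L (insert x I) t) - (\<Prod>t\<in>T. L I t) =
      (\<Sum>U\<in>Pow T - {T}. (\<Prod>t\<in>T - U. a t x) * (\<Prod>t\<in>U. L I t))" if "I \<in> Pow A" for I
  proof -
    have "(\<Prod>t\<in>T. L (insert x I) t) = (\<Prod>t\<in>T. L I t + a t x)"
      using fin[OF that] by (intro prod.cong) (simp_all add: L_def algebra_simps)
    also have "\<dots> = (\<Sum>U\<in>Pow T. (\<Prod>t\<in>U. L I t) * (\<Prod>t\<in>T - U. a t x))"
      using insert.prems by (simp add: prod_add)
    also have "\<dots> = (\<Prod>t\<in>T. L I t) + (\<Sum>U\<in>Pow T - {T}. (\<Prod>t\<in>U. L I t) * (\<Prod>t\<in>T - U. a t x))"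
      using insert.prems by (subst sum.remove[of _ T]) auto
    finally show ?thesis by (simp add: mult.commute)
  qed
  have "(\<Sum>I\<in>Pow (insert x A). (-1) ^ card I * (\<Prod>t\<in>T. L I t)) =
      (\<Sum>I\<in>Pow A. (-1) ^ card I * (\<Prod>t\<in>T. L I t)) +
      (\<Sum>I\<in>insert x ` Pow A. (-1) ^ card I * (\<Prod>t\<in>T. L I t))"
    unfolding Pow_insert using insert.hyps by (intro sum.union_disjoint) auto
  also have "(\<Sum>I\<in>insert x ` Pow A. (-1) ^ card I * (\<Prod>t\<in>T. L I t)) =
      (\<Sum>I\<in>Pow A. (-1) ^ card (insert x I) * (\<Prod>t\<in>T. L (insert x I) t))"
    using insert.hyps by (subst sum.reindex) (auto simp: inj_on_def)
  also have "\<dots> = (\<Sum>I\<in>Pow A. - ((-1) ^ card I * (\<Prod>t\<in>T. L (insert x I) t)))"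
    using fin by (intro sum.cong) auto
  also have "(\<Sum>I\<in>Pow A. (-1) ^ card I * (\<Prod>t\<in>T. L I t)) + \<dots> =
      - (\<Sum>I\<in>Pow A. (-1) ^ card I * ((\<Prod>t\<in>T. L (insert x I) t) - (\<Prod>t\<in>T. L I t)))"
    by (simp add: right_diff_distrib sum_subtractf sum_negf)
  also have "(\<Sum>I\<in>Pow A. (-1) ^ card I * ((\<Prod>t\<in>T. L (insert x I) t) - (\<Prod>t\<in>T. L I t))) =
      (\<Sum>I\<in>Pow A. \<Sum>U\<in>Pow T - {T}. (\<Prod>t\<in>T - U. a t x) * ((-1) ^ card I * (\<Prod>t\<in>U. L I t)))"
    by (intro sum.cong) (simp_all add: diff sum_distrib_left mult_ac)
  also have "\<dots> = (\<Sum>U\<in>Pow T - {T}. (\<Prod>t\<in>T - U. a t x) * (\<Sum>I\<in>Pow A. (-1) ^ card I * (\<Prod>t\<in>U. L I t)))"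
    by (subst sum.swap) (simp add: sum_distrib_left)
  also have "\<dots> = 0"
  proof (intro sum.neutral ballI)
    fix U assume "U \<in> Pow T - {T}"
    then have U: "finite U" "card U < card T"
      using insert.prems by (auto intro: finite_subset psubset_card_mono)
    then have "card U < card A" using insert.prems insert.hyps by simp
    then show "(\<Prod>t\<in>T - U. a t x) * (\<Sum>I\<in>Pow A. (-1) ^ card I * (\<Prod>t\<in>U. L I t)) = 0"
      using insert.IH[OF U(1)] by (simp add: L_def)
  qed
  finally show ?case by (simp add: L_def)
qed

text \<open>Brings the binomial coefficient, up to a factorial, into the shape required by
  \<open>alternating_sum_prod_affine\<close>: a product of \<open>n\<close> affine factors.\<close>

lemma choose_times_fact_eq_prod: "((s + n) choose n) * fact n = (\<Prod>u\<in>{1..n}. s + u)"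
proof (induction n)
  case (Suc n)
  have "((s + Suc n) choose Suc n) * fact (Suc n) = (Suc n * (Suc (s + n) choose Suc n)) * fact n"
    by (simp add: algebra_simps)
  also have "\<dots> = Suc (s + n) * (((s + n) choose n) * fact n)"
    by (simp only: Suc_times_binomial mult.assoc)
  also have "\<dots> = (\<Prod>u\<in>{1..Suc n}. s + u)"
    by (simp add: Suc.IH)
  finally show ?case .
qed simp

section \<open>Binomial coefficients modulo a prime\<close>

lemma prime_dvd_choose_primepow:
  fixes p :: nat
  assumes "prime p" "0 < i" "i < p ^ k"
  shows "p dvd (p ^ k choose i)"
proof (rule ccontr)
  assume "\<not> p dvd (p ^ k choose i)"
  then have "coprime (p ^ k) (p ^ k choose i)"
    using assms(1) by (simp add: prime_imp_coprime)
  \<comment> \<open>Absorption: as \<open>p ^ k\<close> is coprime to the coefficient, it would have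
    to divide the smaller positive number \<open>i\<close>.\<close>
  moreover have "i * (p ^ k choose i) = p ^ k * (p ^ k - 1 choose (i - 1))"
    using assms(2) by (rule times_binomial_minus1_eq)
  then have "p ^ k dvd i * (p ^ k choose i)" by simp
  ultimately have "p ^ k dvd i" by (simp add: coprime_dvd_mult_left_iff)
  then show False using assms by (auto dest: dvd_imp_le)
qed

text \<open>In Vandermonde's expansion only the term \<open>i = 0\<close> survives modulo
  \<open>p\<close>, because \<open>i \<le> j < p ^ k\<close>.\<close>

lemma choose_add_primepow_mod:
  fixes p :: nat
  assumes "prime p" "j < p ^ k"
  shows "[(x + p ^ k) choose j = x choose j] (mod p)"
proof -
  have "(x + p ^ k) choose j = (\<Sum>i\<le>j. ((p ^ k) choose i) * (x choose (j - i)))"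
    by (subst vandermonde) (simp add: add.commute)
  also have "\<dots> = (x choose j) + (\<Sum>i\<in>{..j} - {0}. ((p ^ k) choose i) * (x choose (j - i)))"
    by (subst sum.remove[of _ 0]) auto
  also have "[\<dots> = (x choose j) + 0] (mod p)"
  proof (intro cong_add cong_refl)
    have "p dvd ((p ^ k) choose i) * (x choose (j - i))" if "i \<in> {..j} - {0}" for i
      using that assms by (intro dvd_mult2 prime_dvd_choose_primepow) auto
    then show "[(\<Sum>i\<in>{..j} - {0}. ((p ^ k) choose i) * (x choose (j - i))) = 0] (mod p)"
      unfolding cong_0_iff by (rule dvd_sum)
  qed
  finally show ?thesis by simp
qed

text \<open>Modulo \<open>p\<close> the coefficient has period \<open>q\<close> in \<open>x\<close>,
  so only residues \<open>z < q\<close> matter. For \<open>z > 0\<close> one further period can be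
  removed, which leaves \<open>(z - 1) choose (q - 1) = 0\<close>.\<close>

lemma choose_primepow_indicator:
  fixes p :: nat
  assumes "prime p" and q_def: "q = p ^ k"
  shows "[(x + (q - 1)) choose (q - 1) = (if q dvd x then 1 else 0)] (mod p)"
proof -
  have q: "q > 0" using assms by (simp add: prime_gt_0_nat)
  have per: "[(x + y * q + (q - 1)) choose (q - 1) = (x + (q - 1)) choose (q - 1)] (mod p)" for x y
  proof (induction y)
    case (Suc y)
    have "[(x + y * q + (q - 1) + p ^ k) choose (q - 1) = (x + y * q + (q - 1)) choose (q - 1)] (mod p)"
      by (rule choose_add_primepow_mod) (use assms q in \<open>auto simp: q_def\<close>)
    moreover have "x + Suc y * q + (q - 1) = x + y * q + (q - 1) + p ^ k"
      by (simp add: q_def)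
    ultimately show ?case using Suc.IH by (metis cong_trans)
  qed simp
  have "[(x + (q - 1)) choose (q - 1) = (x mod q + (q - 1)) choose (q - 1)] (mod p)"
    using per[of "x mod q" "x div q"] by simp
  also have "[(x mod q + (q - 1)) choose (q - 1) = (if q dvd x then 1 else 0)] (mod p)"
  proof (cases "q dvd x")
    case False
    define z where "z = x mod q"
    have z: "z < q" "z > 0" using False q by (auto simp: z_def dvd_eq_mod_eq_0)
    then have "z + (q - 1) = (z - 1) + p ^ k" using q by (simp add: q_def)
    moreover have "[((z - 1) + p ^ k) choose (q - 1) = (z - 1) choose (q - 1)] (mod p)"
      by (rule choose_add_primepow_mod) (use assms q in \<open>auto simp: q_def\<close>)
    moreover have "(z - 1) choose (q - 1) = 0" using z by (intro binomial_eq_0) auto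
    ultimately have "[(z + (q - 1)) choose (q - 1) = 0] (mod p)" by metis
    then show ?thesis unfolding z_def if_not_P[OF False] .
  qed (auto simp: mod_eq_0_iff_dvd)
  finally show ?thesis .
qed

text \<open>A sequence is an indexed family of integer vectors and a subsequence is an index set,
  which accounts for repeated terms. The coordinate set \<open>D\<close> is a parameter so that an
  induction on the dimension can delete a coordinate.\<close>

definition sums_to_zero :: "nat \<Rightarrow> 'c set \<Rightarrow> ('i \<Rightarrow> 'c \<Rightarrow> int) \<Rightarrow> 'i set \<Rightarrow> bool" where
  "sums_to_zero n D g I \<longleftrightarrow> (\<forall>c\<in>D. int n dvd (\<Sum>i\<in>I. g i c))"

text \<open>The alternating sum of \<open>F\<close> over the subsets of \<open>J\<close> is
  evaluated twice. It is \<open>0\<close> because \<open>F\<close> has degree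
  \<open>card D * (q - 1) < card J\<close>; it would be \<open>1\<close> modulo \<open>p\<close> if
  only the empty set had sum zero.\<close>

theorem olson_zero_sum:
  fixes g :: "'i \<Rightarrow> 'c \<Rightarrow> int"
  assumes p: "prime p" and q_def: "q = p ^ k" and D: "finite D"
    and J: "finite J" "card J > card D * (q - 1)"
  shows "\<exists>I\<subseteq>J. I \<noteq> {} \<and> sums_to_zero q D g I"
proof (rule ccontr)
  assume none: "\<not> ?thesis"
  have q: "q > 0" using p by (simp add: q_def prime_gt_0_nat)
  \<comment> \<open>Nonnegative representatives, since the binomial coefficients are taken over the
    natural numbers.\<close>
  define x where "x i c = nat (g i c mod int q)" for i c
  define F where "F I = (\<Prod>c\<in>D. ((\<Sum>i\<in>I. x i c) + (q - 1)) choose (q - 1))" for I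
  \<comment> \<open>The identity holds over the integers, so the factorials that clear denominators
    can be cancelled even if \<open>p\<close> divides them.\<close>
  have "(\<Sum>I\<in>Pow J. (-1) ^ card I * int (F I)) * fact (q - 1) ^ card D =
     (\<Sum>I\<in>Pow J. (-1) ^ card I * (\<Prod>t\<in>D \<times> {1..q-1}. int (snd t) + (\<Sum>i\<in>I. int (x i (fst t)))))"
    unfolding sum_distrib_right
  proof (intro sum.cong refl)
    fix I
    have "F I * fact (q - 1) ^ card D = (\<Prod>c\<in>D. \<Prod>u\<in>{1..q-1}. (\<Sum>i\<in>I. x i c) + u)"
      unfolding F_def choose_times_fact_eq_prod[symmetric] prod.distrib by simp
    also have "\<dots> = (\<Prod>t\<in>D \<times> {1..q-1}. (\<Sum>i\<in>I. x i (fst t)) + snd t)"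
      by (simp add: prod.cartesian_product case_prod_beta)
    finally have "int (F I * fact (q - 1) ^ card D) = int (\<Prod>t\<in>D \<times> {1..q-1}. (\<Sum>i\<in>I. x i (fst t)) + snd t)"
      by simp
    then show "(-1) ^ card I * int (F I) * fact (q - 1) ^ card D =
      (-1) ^ card I * (\<Prod>t\<in>D \<times> {1..q-1}. int (snd t) + (\<Sum>i\<in>I. int (x i (fst t))))"
      by (simp add: add.commute)
  qed
  also have "\<dots> = 0"
    using D J by (intro alternating_sum_prod_affine) (auto simp: card_cartesian_product)
  finally have zero: "(\<Sum>I\<in>Pow J. (-1) ^ card I * int (F I)) = 0" by simp
  have ind: "[int (F I) = (if sums_to_zero q D g I then 1 else 0)] (mod int p)" for I
  proof -
    have "q dvd (\<Sum>i\<in>I. x i c) \<longleftrightarrow> int q dvd (\<Sum>i\<in>I. g i c)" for c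
    proof -
      have "int (\<Sum>i\<in>I. x i c) = (\<Sum>i\<in>I. g i c mod int q)"
        using q by (simp add: x_def)
      moreover have "(\<Sum>i\<in>I. g i c mod int q) mod int q = (\<Sum>i\<in>I. g i c) mod int q"
        by (rule mod_sum_eq)
      ultimately show ?thesis
        by (metis dvd_eq_mod_eq_0 int_dvd_int_iff)
    qed
    then have "sums_to_zero q D g I \<longleftrightarrow> (\<forall>c\<in>D. q dvd (\<Sum>i\<in>I. x i c))"
      by (simp add: sums_to_zero_def)
    then have "(\<Prod>c\<in>D. if q dvd (\<Sum>i\<in>I. x i c) then 1 else 0 :: nat) = (if sums_to_zero q D g I then 1 else 0)"
      using D by auto
    moreover have "[F I = (\<Prod>c\<in>D. if q dvd (\<Sum>i\<in>I. x i c) then 1 else 0)] (mod p)"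
      unfolding F_def by (intro cong_prod choose_primepow_indicator[OF p q_def])
    ultimately have "[F I = (if sums_to_zero q D g I then 1 else 0)] (mod p)" by simp
    then show ?thesis by (simp flip: cong_int_iff split: if_splits)
  qed
  have "[(\<Sum>I\<in>Pow J. (-1) ^ card I * int (F I)) =
      (\<Sum>I\<in>Pow J. (-1) ^ card I * (if sums_to_zero q D g I then 1 else 0))] (mod int p)"
    by (intro cong_sum cong_mult ind cong_refl)
  also have "(\<Sum>I\<in>Pow J. (-1) ^ card I * (if sums_to_zero q D g I then 1 else 0)) =
      (\<Sum>I\<in>{{}}. (-1) ^ card I * (if sums_to_zero q D g I then 1 else 0 :: int))"
    using none J by (intro sum.mono_neutral_right) auto
  also have "\<dots> = 1" by (simp add: sums_to_zero_def)
  finally have "int p dvd 1" using zero by (simp add: cong_0_iff cong_sym_eq)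
  then show False using p by auto
qed

section \<open>Extraction of zero-sum blocks\<close>

text \<open>Greedy choice: for \<open>t > 0\<close> the bound on \<open>card J\<close> says that
  \<open>N\<close> terms are left after \<open>t - 1\<close> blocks of at most \<open>m\<close>
  terms.\<close>

lemma disjoint_blocks:
  assumes short: "\<And>J. finite J \<Longrightarrow> N \<le> card J \<Longrightarrow> \<exists>I\<subseteq>J. I \<noteq> {} \<and> card I \<le> m \<and> P I"
    and J: "finite J" "m * t + N \<le> card J + m"
  shows "\<exists>B :: nat \<Rightarrow> 'i set. (\<forall>s<t. B s \<subseteq> J \<and> B s \<noteq> {} \<and> card (B s) \<le> m \<and> P (B s)) \<and> disjoint_family_on B {..<t}"
  using J
proof (induction t arbitrary: J)
  case 0
  then show ?case by (auto simp: disjoint_family_on_def)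
next
  case (Suc t)
  then have "N \<le> card J" by simp
  then obtain I where I: "I \<subseteq> J" "I \<noteq> {}" "card I \<le> m" "P I"
    using short Suc.prems(1) by blast
  have "card J = card I + card (J - I)"
    using I Suc.prems by (metis card_Diff_subset card_mono finite_subset le_add_diff_inverse)
  then have "m * t + N \<le> card (J - I) + m" using Suc.prems I by simp
  then obtain B where B: "\<forall>s<t. B s \<subseteq> J - I \<and> B s \<noteq> {} \<and> card (B s) \<le> m \<and> P (B s)"
      "disjoint_family_on B {..<t}"
    using Suc.IH[of "J - I"] Suc.prems(1) by blast
  have "\<forall>s<Suc t. (B(t := I)) s \<subseteq> J \<and> (B(t := I)) s \<noteq> {} \<and> card ((B(t := I)) s) \<le> m \<and> P ((B(t := I)) s)"
    using B I by (auto simp: less_Suc_eq)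
  moreover have "disjoint_family_on (B(t := I)) {..<Suc t}"
    unfolding disjoint_family_on_def
  proof (intro ballI impI)
    fix a b assume "a \<in> {..<Suc t}" "b \<in> {..<Suc t}" "a \<noteq> b"
    then consider "a < t" "b < t" | "a = t" "b < t" | "b = t" "a < t"
      by (auto simp: less_Suc_eq)
    then show "(B(t := I)) a \<inter> (B(t := I)) b = {}"
    proof cases
      case 1
      then show ?thesis using B(2) \<open>a \<noteq> b\<close> by (simp add: disjoint_family_on_def)
    next
      case 2
      then show ?thesis using B(1) by auto
    next
      case 3
      then show ?thesis using B(1) by auto
    qed
  qed
  ultimately show ?case by blast
qed

text \<open>The block sums divided by \<open>m\<close> form a new sequence of length
  \<open>t\<close>; a subsequence with sum zero modulo \<open>n\<close> selects the blocks to unite.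
  The length bounds multiply, so the construction can be iterated over the factors of a
  modulus.\<close>

lemma zero_sum_blocks_mult:
  fixes g :: "'i \<Rightarrow> 'c \<Rightarrow> int"
  assumes short: "\<And>J. finite J \<Longrightarrow> N \<le> card J \<Longrightarrow> \<exists>I\<subseteq>J. I \<noteq> {} \<and> card I \<le> m \<and> sums_to_zero m D g I"
    and next_step: "\<And>h :: nat \<Rightarrow> 'c \<Rightarrow> int. \<exists>I\<subseteq>{..<t}. I \<noteq> {} \<and> card I \<le> M \<and> sums_to_zero n D h I"
    and J: "finite J" "m * t + N \<le> card J + m"
  shows "\<exists>I\<subseteq>J. I \<noteq> {} \<and> card I \<le> m * M \<and> sums_to_zero (m * n) D g I"
proof -
  obtain B where B: "\<And>s. s < t \<Longrightarrow> B s \<subseteq> J \<and> B s \<noteq> {} \<and> card (B s) \<le> m \<and> sums_to_zero m D g (B s)"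
      "disjoint_family_on B {..<t}"
    using disjoint_blocks[of N m "sums_to_zero m D g", OF short J] by blast
  define h where "h s c = (\<Sum>i\<in>B s. g i c) div int m" for s c
  obtain I where I: "I \<subseteq> {..<t}" "I \<noteq> {}" "card I \<le> M" "sums_to_zero n D h I"
    using next_step[of h] by blast
  have sub: "\<And>s. s \<in> I \<Longrightarrow> s < t" and finI: "finite I"
    using I by (auto intro: finite_subset)
  have finB: "finite (B s)" if "s \<in> I" for s
    using B(1)[OF sub[OF that]] J by (auto intro: finite_subset)
  have disj: "\<forall>s\<in>I. \<forall>s'\<in>I. s \<noteq> s' \<longrightarrow> B s \<inter> B s' = {}"
    using B(2) I(1) by (auto simp: disjoint_family_on_def)
  have "card (\<Union>s\<in>I. B s) \<le> (\<Sum>s\<in>I. card (B s))" using finI by (rule card_UN_le)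
  also have "\<dots> \<le> (\<Sum>s\<in>I. m)" using B(1) sub by (intro sum_mono) auto
  also have "\<dots> \<le> m * M" using I(3) by simp
  finally have card: "card (\<Union>s\<in>I. B s) \<le> m * M" .
  have "sums_to_zero (m * n) D g (\<Union>s\<in>I. B s)"
    unfolding sums_to_zero_def
  proof
    fix c assume c: "c \<in> D"
    have "(\<Sum>i\<in>(\<Union>s\<in>I. B s). g i c) = (\<Sum>s\<in>I. \<Sum>i\<in>B s. g i c)"
      using finI finB disj by (intro sum.UNION_disjoint) auto
    also have "\<dots> = (\<Sum>s\<in>I. int m * h s c)"
      using B(1) sub c by (intro sum.cong) (auto simp: h_def sums_to_zero_def)
    also have "\<dots> = int m * (\<Sum>s\<in>I. h s c)" by (simp add: sum_distrib_left)
    finally show "int (m * n) dvd (\<Sum>i\<in>(\<Union>s\<in>I. B s). g i c)"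
      using I(4) c by (simp add: sums_to_zero_def mult_dvd_mono)
  qed
  moreover have "(\<Union>s\<in>I. B s) \<subseteq> J" "(\<Union>s\<in>I. B s) \<noteq> {}"
    using B(1) sub I(2) by blast+
  ultimately show ?thesis using card by blast
qed

section \<open>Translations of sets of vectors modulo a prime\<close>

lemma sum_card_swap:
  assumes "finite A" "finite B"
  shows "(\<Sum>x\<in>A. card {y \<in> B. P x y}) = (\<Sum>y\<in>B. card {x \<in> A. P x y})"
proof -
  have "(\<Sum>x\<in>A. card {y \<in> B. P x y}) = (\<Sum>x\<in>A. \<Sum>y\<in>B. if P x y then 1 else 0)"
    using assms by (simp add: sum.If_cases Int_def)
  also have "\<dots> = (\<Sum>y\<in>B. \<Sum>x\<in>A. if P x y then 1 else 0)" by (rule sum.swap)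
  also have "\<dots> = (\<Sum>y\<in>B. card {x \<in> A. P x y})"
    using assms by (simp add: sum.If_cases Int_def)
  finally show ?thesis .
qed

locale mod_vectors =
  fixes p :: nat and D :: "'c set"
  assumes prime_p: "prime p" and finite_D: "finite D"
begin

text \<open>The vector space over the field with \<open>p\<close> elements, by reduced
  representatives that are undefined outside \<open>D\<close>; congruence of vectors becomes
  equality after \<open>red\<close>.\<close>

definition V :: "('c \<Rightarrow> int) set" where "V = (\<Pi>\<^sub>E c\<in>D. {0..<int p})"

definition red :: "('c \<Rightarrow> int) \<Rightarrow> 'c \<Rightarrow> int" where "red x = (\<lambda>c\<in>D. x c mod int p)"

definition shift :: "('c \<Rightarrow> int) \<Rightarrow> ('c \<Rightarrow> int) \<Rightarrow> 'c \<Rightarrow> int" where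
  "shift v y = red (\<lambda>c. y c + v c)"

text \<open>For \<open>Y \<subseteq> V\<close> this is the growth of \<open>Y\<close> when its
  translate by \<open>v\<close> is united with it; in \<open>v\<close> it behaves like a
  length.\<close>

definition leak :: "('c \<Rightarrow> int) set \<Rightarrow> ('c \<Rightarrow> int) \<Rightarrow> nat" where
  "leak Y v = card {y \<in> Y. shift v y \<notin> Y}"

definition dot :: "('c \<Rightarrow> int) \<Rightarrow> ('c \<Rightarrow> int) \<Rightarrow> int" where
  "dot l x = (\<Sum>c\<in>D. l c * x c)"

text \<open>No affine hyperplane, with normal vector \<open>l\<close> and level \<open>a\<close>,
  carries \<open>h\<close> of the terms.\<close>

definition rich :: "'i set \<Rightarrow> ('i \<Rightarrow> 'c \<Rightarrow> int) \<Rightarrow> nat \<Rightarrow> bool" where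
  "rich R g h \<longleftrightarrow> (\<forall>l\<in>V. (\<exists>c\<in>D. l c \<noteq> 0) \<longrightarrow>
     (\<forall>a. card {i \<in> R. [dot l (g i) = a] (mod int p)} < h))"

lemma p_pos: "p > 0" using prime_p by (simp add: prime_gt_0_nat)

lemma prime_int_p: "prime (int p)" using prime_p by simp

lemma finite_V: "finite V" unfolding V_def using finite_D by (intro finite_PiE) auto

lemma card_V: "card V = p ^ card D" unfolding V_def using finite_D by (simp add: card_PiE)

lemma red_in_V [simp]: "red x \<in> V" using p_pos by (auto simp: red_def V_def)

lemma red_V: "x \<in> V \<Longrightarrow> red x = x" by (fastforce simp: red_def V_def PiE_iff extensional_def)

lemma red_eq_iff: "red x = red y \<longleftrightarrow> (\<forall>c\<in>D. [x c = y c] (mod int p))"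
  by (auto simp: red_def cong_def fun_eq_iff restrict_def)

lemma red_add_red: "red (\<lambda>c. red x c + y c) = red (\<lambda>c. x c + y c)"
  by (auto simp: red_eq_iff cong_def red_def mod_simps)

lemma red_add_red': "red (\<lambda>c. x c + red y c) = red (\<lambda>c. x c + y c)"
  by (auto simp: red_eq_iff cong_def red_def mod_simps)

lemma shift_in_V [simp]: "shift v y \<in> V" by (simp add: shift_def)

lemma shift_red: "shift (red v) y = shift v y" by (simp add: shift_def red_add_red')

lemma shift_shift: "shift u (shift v y) = shift (\<lambda>c. v c + u c) y"
  by (simp add: shift_def red_add_red add.assoc)

lemma shift_zero: "y \<in> V \<Longrightarrow> shift (\<lambda>_. 0) y = y" by (simp add: shift_def red_V)

lemma inj_on_shift: "inj_on (shift v) V"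
proof (rule inj_onI)
  fix x y assume xy: "x \<in> V" "y \<in> V" "shift v x = shift v y"
  then have "red x = red y" by (simp add: shift_def red_eq_iff cong_add_rcancel)
  then show "x = y" using xy by (simp add: red_V)
qed

lemma shift_eq_iff: "\<lbrakk>x \<in> V; x' \<in> V\<rbrakk> \<Longrightarrow> shift x y = shift x' y \<longleftrightarrow> x = x'"
  using red_eq_iff[of x x'] by (simp add: shift_def red_eq_iff cong_add_lcancel red_V)

lemma leak_red: "leak Y (red v) = leak Y v" by (simp add: leak_def shift_red)

lemma leak_zero: "Y \<subseteq> V \<Longrightarrow> leak Y (\<lambda>_. 0) = 0"
proof -
  assume "Y \<subseteq> V"
  then have "{y \<in> Y. shift (\<lambda>_. 0) y \<notin> Y} = {}" by (auto simp: shift_zero subset_iff)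
  then show ?thesis by (simp only: leak_def card.empty)
qed

text \<open>A point that leaves \<open>Y\<close> under \<open>u + v\<close> either leaves under
  \<open>u\<close>, or its translate by \<open>u\<close> is still in \<open>Y\<close> and leaves
  under \<open>v\<close>.\<close>

lemma leak_add:
  assumes "Y \<subseteq> V"
  shows "leak Y (\<lambda>c. u c + v c) \<le> leak Y u + leak Y v"
proof -
  have fin: "finite Y" using assms finite_V by (rule finite_subset)
  define A where "A = {y \<in> Y. shift u y \<in> Y \<and> shift v (shift u y) \<notin> Y}"
  have "leak Y (\<lambda>c. u c + v c) \<le> card ({y \<in> Y. shift u y \<notin> Y} \<union> A)"
    unfolding leak_def using fin by (intro card_mono) (auto simp: A_def shift_shift)
  also have "\<dots> \<le> leak Y u + card A" unfolding leak_def by (rule card_Un_le)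
  also have "card A \<le> leak Y v"
    unfolding leak_def
    by (rule card_inj_on_le[where f = "shift u"])
      (use assms fin in \<open>auto simp: A_def intro: inj_on_subset[OF inj_on_shift]\<close>)
  finally show ?thesis by simp
qed

lemma leak_mult:
  assumes "Y \<subseteq> V"
  shows "leak Y (\<lambda>c. int k * v c) \<le> k * leak Y v"
proof (induction k)
  case 0
  show ?case using assms by (simp add: leak_zero)
next
  case (Suc k)
  have "leak Y (\<lambda>c. int (Suc k) * v c) = leak Y (\<lambda>c. v c + int k * v c)"
    by (simp add: algebra_simps)
  also have "\<dots> \<le> leak Y v + leak Y (\<lambda>c. int k * v c)" using assms by (rule leak_add)
  finally show ?case using Suc.IH by simp
qed

lemma leak_sum:
  assumes "Y \<subseteq> V" "finite L"
  shows "leak Y (\<lambda>c. \<Sum>s\<in>L. v s c) \<le> (\<Sum>s\<in>L. leak Y (v s))"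
  using assms(2)
proof (induction L)
  case empty
  show ?case using assms by (simp add: leak_zero)
next
  case (insert s L)
  have "leak Y (\<lambda>c. \<Sum>s\<in>insert s L. v s c) = leak Y (\<lambda>c. v s c + (\<Sum>s\<in>L. v s c))"
    using insert.hyps by simp
  also have "\<dots> \<le> leak Y (v s) + leak Y (\<lambda>c. \<Sum>s\<in>L. v s c)"
    using assms(1) by (rule leak_add)
  finally show ?case using insert by simp
qed

lemma card_union_shift:
  assumes "Y \<subseteq> V"
  shows "card (Y \<union> shift v ` Y) = card Y + leak Y v"
proof -
  have fin: "finite Y" using assms finite_V by (rule finite_subset)
  have "card (Y \<union> shift v ` {y \<in> Y. shift v y \<notin> Y}) = card Y + card (shift v ` {y \<in> Y. shift v y \<notin> Y})"
    using fin by (intro card_Un_disjoint) auto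
  also have "card (shift v ` {y \<in> Y. shift v y \<notin> Y}) = leak Y v"
    unfolding leak_def using assms by (intro card_image inj_on_subset[OF inj_on_shift]) auto
  moreover have "Y \<union> shift v ` {y \<in> Y. shift v y \<notin> Y} = Y \<union> shift v ` Y" by auto
  ultimately show ?thesis by simp
qed

section \<open>Linear forms and independent differences\<close>

lemma dot_cong: "red x = red y \<Longrightarrow> [dot l x = dot l y] (mod int p)"
  unfolding dot_def red_eq_iff by (intro cong_sum cong_mult) auto

lemma dot_diff: "dot l (\<lambda>c. x c - y c) = dot l x - dot l y"
  by (simp add: dot_def right_diff_distrib sum_subtractf)

lemma dot_scale: "dot l (\<lambda>c. a * x c) = a * dot l x"
  by (simp add: dot_def sum_distrib_left mult_ac)

lemma dot_add: "dot l (\<lambda>c. x c + y c) = dot l x + dot l y"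
  by (simp add: dot_def distrib_left sum.distrib)

lemma dot_sum: "dot l (\<lambda>c. \<Sum>s\<in>L. a s * x s c) = (\<Sum>s\<in>L. a s * dot l (x s))"
  unfolding dot_def sum_distrib_left by (subst sum.swap) (simp add: mult_ac)

text \<open>Pigeonhole: the \<open>m\<close> forms have fewer joint values than \<open>V\<close> has
  elements, so two vectors agree on all of them; \<open>l\<close> is their difference.\<close>

lemma exists_orthogonal:
  assumes "m < card D"
  shows "\<exists>l\<in>V. (\<exists>c\<in>D. l c \<noteq> 0) \<and> (\<forall>s<m. int p dvd dot l (b s))"
proof -
  define f where "f l = (\<lambda>s\<in>{..<m}. dot l (b s) mod int p)" for l
  define T where "T = (\<Pi>\<^sub>E s\<in>{..<m}. {0..<int p})"
  have "f ` V \<subseteq> T" using p_pos by (auto simp: f_def T_def PiE_iff split: if_splits)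
  moreover have "finite T" "card T = p ^ m" by (simp_all add: T_def card_PiE finite_PiE)
  moreover have "p ^ m < p ^ card D"
    using assms prime_gt_1_nat[OF prime_p] by (intro power_strict_increasing)
  ultimately have "\<not> inj_on f V" by (metis card_V card_inj_on_le leD)
  then obtain l1 l2 where l: "l1 \<in> V" "l2 \<in> V" "f l1 = f l2" "l1 \<noteq> l2"
    by (auto simp: inj_on_def)
  define l where "l = red (\<lambda>c. l1 c - l2 c)"
  have "\<exists>c\<in>D. l c \<noteq> 0"
  proof (rule ccontr)
    assume "\<not> ?thesis"
    then have "\<forall>c\<in>D. (l1 c - l2 c) mod int p = 0" by (simp add: l_def red_def)
    then have "red l1 = red l2"
      by (simp add: red_eq_iff cong_iff_dvd_diff dvd_eq_mod_eq_0)
    then show False using l by (simp add: red_V)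
  qed
  moreover have "int p dvd dot l (b s)" if "s < m" for s
  proof -
    have "[dot l (b s) = (\<Sum>c\<in>D. (l1 c - l2 c) * b s c)] (mod int p)"
      unfolding dot_def by (intro cong_sum cong_mult cong_refl) (simp add: l_def red_def cong_def)
    also have "(\<Sum>c\<in>D. (l1 c - l2 c) * b s c) = dot l1 (b s) - dot l2 (b s)"
      by (simp add: dot_def left_diff_distrib sum_subtractf)
    finally have "[dot l (b s) = dot l1 (b s) - dot l2 (b s)] (mod int p)" .
    moreover have "[dot l1 (b s) = dot l2 (b s)] (mod int p)"
      using that fun_cong[OF l(3), of s] by (simp add: f_def cong_def)
    ultimately show ?thesis by (metis cong_dvd_iff cong_iff_dvd_diff)
  qed
  ultimately show ?thesis by (intro bexI[of _ l]) (auto simp: l_def)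
qed

text \<open>Independence is recorded as injectivity on boxes of coefficients, the form used for
  counting. Given \<open>l\<close> orthogonal to the differences chosen so far, richness yields a
  term off the hyperplane through \<open>g i\<close> with normal \<open>l\<close>, and it provides
  the next difference.\<close>

lemma independent_differences:
  assumes R: "finite R" "rich R g h" "h \<le> card R" and "m \<le> card D" "k \<le> p"
  shows "\<exists>b :: nat \<Rightarrow> 'c \<Rightarrow> int. (\<forall>s<m. \<exists>j\<in>R. b s = (\<lambda>c. g j c - g i c)) \<and>
    inj_on (\<lambda>a. red (\<lambda>c. \<Sum>s<m. a s * b s c)) (\<Pi>\<^sub>E s\<in>{..<m}. {0..<int k})"
  using \<open>m \<le> card D\<close>
proof (induction m)
  case 0
  show ?case by auto
next
  case (Suc m)
  then obtain b where b: "\<And>s. s < m \<Longrightarrow> \<exists>j\<in>R. b s = (\<lambda>c. g j c - g i c)"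
    "inj_on (\<lambda>a. red (\<lambda>c. \<Sum>s<m. a s * b s c)) (\<Pi>\<^sub>E s\<in>{..<m}. {0..<int k})"
    using Suc.IH[OF Suc_leD[OF Suc.prems]] by blast
  obtain l where l: "l \<in> V" "\<exists>c\<in>D. l c \<noteq> 0" "\<And>s. s < m \<Longrightarrow> int p dvd dot l (b s)"
    using exists_orthogonal[of m b] Suc.prems by auto
  have "card {j \<in> R. [dot l (g j) = dot l (g i)] (mod int p)} < card R"
    using R(2,3) l(1,2) unfolding rich_def by (auto intro: less_le_trans)
  then have "{j \<in> R. [dot l (g j) = dot l (g i)] (mod int p)} \<noteq> R" by auto
  then obtain j where j: "j \<in> R" "\<not> [dot l (g j) = dot l (g i)] (mod int p)" by blast
  define u where "u = (\<lambda>c. g j c - g i c)"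
  define b' where "b' = b(m := u)"
  have lu: "\<not> int p dvd dot l u" using j by (simp add: u_def dot_diff cong_iff_dvd_diff)
  have split: "(\<Sum>s<Suc m. a s * b' s c) = (\<Sum>s<m. a s * b s c) + a m * u c" for a c
    by (simp add: b'_def)
  have "inj_on (\<lambda>a. red (\<lambda>c. \<Sum>s<Suc m. a s * b' s c)) (\<Pi>\<^sub>E s\<in>{..<Suc m}. {0..<int k})"
  proof (rule inj_onI)
    fix a a' assume a: "a \<in> (\<Pi>\<^sub>E s\<in>{..<Suc m}. {0..<int k})" "a' \<in> (\<Pi>\<^sub>E s\<in>{..<Suc m}. {0..<int k})"
      and "red (\<lambda>c. \<Sum>s<Suc m. a s * b' s c) = red (\<lambda>c. \<Sum>s<Suc m. a' s * b' s c)"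
    then have eq: "red (\<lambda>c. (\<Sum>s<m. a s * b s c) + a m * u c) = red (\<lambda>c. (\<Sum>s<m. a' s * b s c) + a' m * u c)"
      by (simp only: split)
    \<comment> \<open>Applying \<open>l\<close> annihilates the earlier differences and isolates the
      coefficient of \<open>u\<close>. It is determined modulo \<open>p\<close>, hence exactly, as
      \<open>k \<le> p\<close>.\<close>
    have zero: "int p dvd (\<Sum>s<m. a s * dot l (b s))" for a :: "nat \<Rightarrow> int"
      using l(3) by (intro dvd_sum) auto
    have "[(\<Sum>s<m. a s * dot l (b s)) + a m * dot l u = (\<Sum>s<m. a' s * dot l (b s)) + a' m * dot l u] (mod int p)"
      using dot_cong[OF eq, of l] by (simp add: dot_add dot_sum dot_scale)
    then have "int p dvd ((\<Sum>s<m. a s * dot l (b s)) - (\<Sum>s<m. a' s * dot l (b s))) + (a m - a' m) * dot l u"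
      by (simp add: cong_iff_dvd_diff algebra_simps)
    then have "int p dvd (a m - a' m) * dot l u"
      using zero by (simp add: dvd_add_right_iff)
    then have "[a m = a' m] (mod int p)"
      using lu prime_int_p by (auto simp: prime_dvd_mult_iff cong_iff_dvd_diff)
    moreover have "a m \<in> {0..<int k}" "a' m \<in> {0..<int k}"
      using a[THEN PiE_mem, of m] by simp_all
    then have "0 \<le> a m" "a m < int p" "0 \<le> a' m" "a' m < int p" using \<open>k \<le> p\<close> by auto
    ultimately have am: "a m = a' m" by (intro cong_less_imp_eq_int)
    have "red (\<lambda>c. \<Sum>s<m. a s * b s c) = red (\<lambda>c. \<Sum>s<m. a' s * b s c)"
      using eq by (simp add: am red_eq_iff cong_add_rcancel)
    then have "red (\<lambda>c. \<Sum>s<m. restrict a {..<m} s * b s c) = red (\<lambda>c. \<Sum>s<m. restrict a' {..<m} s * b s c)"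
      by simp
    then have "restrict a {..<m} = restrict a' {..<m}"
      using a by (intro inj_onD[OF b(2)]) (auto simp: PiE_iff)
    then have "a s = a' s" if "s < m" for s using that by (metis lessThan_iff restrict_apply')
    then show "a = a'" using a am by (intro PiE_ext[OF a]) (auto simp: less_Suc_eq)
  qed
  moreover have "\<forall>s<Suc m. \<exists>j\<in>R. b' s = (\<lambda>c. g j c - g i c)"
    using b(1) j(1) by (auto simp: b'_def u_def less_Suc_eq)
  ultimately show ?case by blast
qed

lemma card_stay: "finite Y \<Longrightarrow> card {y \<in> Y. shift v y \<in> Y} + leak Y v = card Y"
  unfolding leak_def by (subst card_Un_disjoint[symmetric]) (auto intro: arg_cong[where f = card])

text \<open>The combinations of \<open>card D\<close> independent differences with coefficients below \<open>k\<close> are too many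
  for \<open>Y\<close> to be almost invariant under all of them.\<close>

lemma leak_box:
  assumes R: "finite R" "rich R g h" "h \<le> card R"
    and Y: "Y \<subseteq> V" "2 * card Y \<le> k ^ card D" and k: "k \<le> p" and i: "i \<in> R"
  shows "\<exists>j\<in>R. card Y \<le> 2 * card D * k * leak Y (\<lambda>c. g j c - g i c)"
proof (rule ccontr)
  assume "\<not> ?thesis"
  then have small: "\<And>j. j \<in> R \<Longrightarrow> 2 * card D * k * leak Y (\<lambda>c. g j c - g i c) < card Y"
    by (simp add: not_le)
  define d where "d = card D"
  have fin: "finite Y" using Y finite_V by (auto intro: finite_subset)
  have Ypos: "card Y > 0" using small[OF i] by simp
  have "d > 0" using Y Ypos by (cases "d = 0") (auto simp: d_def)
  obtain b where b: "\<And>s. s < d \<Longrightarrow> \<exists>j\<in>R. b s = (\<lambda>c. g j c - g i c)"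
    and inj: "inj_on (\<lambda>a. red (\<lambda>c. \<Sum>s<d. a s * b s c)) (\<Pi>\<^sub>E s\<in>{..<d}. {0..<int k})"
    using independent_differences[OF R, of d k i] k unfolding d_def by auto
  define X where "X = (\<lambda>a. red (\<lambda>c. \<Sum>s<d. a s * b s c)) ` (\<Pi>\<^sub>E s\<in>{..<d}. {0..<int k})"
  have X: "X \<subseteq> V" "card X = k ^ d"
  proof -
    show "X \<subseteq> V" by (simp add: X_def image_subset_iff)
    show "card X = k ^ d" unfolding X_def card_image[OF inj] by (simp add: card_PiE)
  qed
  have finX: "finite X" using X finite_V by (auto intro: finite_subset)
  \<comment> \<open>Subadditivity: \<open>x\<close> combines \<open>d\<close> differences with
    coefficients below \<open>k\<close>, and each of them is assumed to leak less than
    \<open>card Y / (2 * d * k)\<close>.\<close>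
  have leakX: "2 * leak Y x < card Y" if "x \<in> X" for x
  proof -
    obtain a where a: "a \<in> (\<Pi>\<^sub>E s\<in>{..<d}. {0..<int k})" "x = red (\<lambda>c. \<Sum>s<d. a s * b s c)"
      using \<open>x \<in> X\<close> by (auto simp: X_def)
    have "leak Y x \<le> (\<Sum>s<d. leak Y (\<lambda>c. a s * b s c))"
      unfolding a leak_red using Y by (intro leak_sum) auto
    also have "\<dots> \<le> (\<Sum>s<d. k * leak Y (b s))"
    proof (intro sum_mono)
      fix s assume "s \<in> {..<d}"
      then have as: "0 \<le> a s" "a s < int k" using a(1) by (auto simp: PiE_iff)
      then have "leak Y (\<lambda>c. a s * b s c) \<le> nat (a s) * leak Y (b s)"
        using leak_mult[OF Y(1), of "nat (a s)" "b s"] by simp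
      also have "\<dots> \<le> k * leak Y (b s)" using as by (intro mult_right_mono) auto
      finally show "leak Y (\<lambda>c. a s * b s c) \<le> k * leak Y (b s)" .
    qed
    finally have "2 * d * leak Y x \<le> 2 * d * (\<Sum>s<d. k * leak Y (b s))" by simp
    also have "\<dots> = (\<Sum>s<d. 2 * d * k * leak Y (b s))" by (simp add: sum_distrib_left mult_ac)
    also have "\<dots> < (\<Sum>s<d. card Y)"
    proof (intro sum_strict_mono)
      show "{..<d} \<noteq> {}" using \<open>d > 0\<close> by auto
      fix s assume "s \<in> {..<d}"
      then obtain j where "j \<in> R" "b s = (\<lambda>c. g j c - g i c)" using b by auto
      then show "2 * d * k * leak Y (b s) < card Y" using small[of j] by (simp add: d_def)
    qed simp
    finally have "d * (2 * leak Y x) < d * card Y" by (simp add: mult_ac)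
    then show ?thesis using \<open>d > 0\<close> by simp
  qed
  have "k ^ d > 0" using Y Ypos unfolding d_def by linarith
  then have "X \<noteq> {}" using X by auto
  \<comment> \<open>Pairs with \<open>shift x y \<in> Y\<close> are counted twice: each
    \<open>x\<close> keeps more than half of \<open>Y\<close>, but for fixed \<open>y\<close>
    distinct \<open>x\<close> have distinct images, so at most \<open>card Y\<close> of them
    qualify.\<close>
  have "card X * card Y = (\<Sum>x\<in>X. card Y)" by simp
  also have "\<dots> < (\<Sum>x\<in>X. 2 * card {y \<in> Y. shift x y \<in> Y})"
  proof (intro sum_strict_mono finX \<open>X \<noteq> {}\<close>)
    fix x assume "x \<in> X"
    then show "card Y < 2 * card {y \<in> Y. shift x y \<in> Y}"
      using leakX[of x] card_stay[OF fin, of x] by linarith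
  qed
  also have "\<dots> = 2 * (\<Sum>y\<in>Y. card {x \<in> X. shift x y \<in> Y})"
    using sum_card_swap[OF finX fin, of "\<lambda>x y. shift x y \<in> Y"] by (simp add: sum_distrib_left[symmetric])
  also have "\<dots> \<le> 2 * (\<Sum>y\<in>Y. card Y)"
  proof (intro mult_left_mono sum_mono)
    fix y
    show "card {x \<in> X. shift x y \<in> Y} \<le> card Y"
      by (rule card_inj_on_le[where f = "\<lambda>x. shift x y"])
        (use X fin in \<open>auto simp: inj_on_def shift_eq_iff subset_iff\<close>)
  qed simp
  also have "\<dots> = (2 * card Y) * card Y" by simp
  also have "\<dots> \<le> card X * card Y" using Y X by (intro mult_right_mono) (auto simp: d_def)
  finally show False by simp
qed

end

section \<open>Fourier analysis\<close>

lemma sum_cis_roots_of_unity: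
  fixes p :: nat and x :: int
  assumes "p > 0"
  shows "(\<Sum>t\<in>{0..<int p}. cis (2 * pi * of_int (t * x) / p)) = (if int p dvd x then of_nat p else 0)"
proof -
  define z where "z = cis (2 * pi * of_int x / p)"
  have "{0..<int p} = int ` {..<p}" by (simp add: image_int_atLeastLessThan lessThan_atLeast0)
  then have "(\<Sum>t\<in>{0..<int p}. cis (2 * pi * of_int (t * x) / p)) = (\<Sum>t<p. z ^ t)"
    by (simp add: sum.reindex z_def DeMoivre mult_ac)
  also have "\<dots> = (if int p dvd x then of_nat p else 0)"
  proof (cases "int p dvd x")
    case True
    then obtain y where "x = int p * y" by blast
    then have "2 * pi * of_int x / p = 2 * pi * of_int y" using assms by simp
    then have "z = 1" unfolding z_def by (simp only: cis_multiple_2pi Ints_of_int)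
    then show ?thesis using True by simp
  next
    case False
    have "z \<noteq> 1"
    proof
      assume "z = 1"
      then have "cos (2 * pi * of_int x / p) = 1" by (metis Re_complex_of_real cis.sel(1) of_real_1 z_def)
      then obtain y :: int where "2 * pi * of_int x / p = of_int y * 2 * pi"
        by (auto simp: cos_one_2pi_int)
      then have "of_int x = (of_int (y * int p) :: real)" using assms by (simp add: field_simps)
      then have "x = y * int p" by (simp only: of_int_eq_iff)
      then show False using False by simp
    qed
    moreover have "z ^ p = 1" using assms by (simp add: z_def DeMoivre)
    ultimately show ?thesis using False by (simp add: geometric_sum)
  qed
  finally show ?thesis .
qed

text \<open>A weak form of Jordan's inequality: up to \<open>pi / 3\<close> the derivative of sine
  is at least \<open>1 / 2\<close>, and afterwards sine stays above
  \<open>1 / 2 \<ge> x / pi\<close>.\<close>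

lemma divide_pi_le_sin:
  fixes x :: real
  assumes "0 \<le> x" "x \<le> pi / 2"
  shows "x / pi \<le> sin x"
proof (cases "x \<le> pi / 3")
  case True
  have "(\<lambda>t. sin t - t / 2) 0 \<le> (\<lambda>t. sin t - t / 2) x"
  proof (rule DERIV_nonneg_imp_nondecreasing[OF assms(1)])
    fix t assume t: "0 \<le> t" "t \<le> x"
    have "cos (pi / 3) \<le> cos t" using t True by (intro cos_monotone_0_pi_le) auto
    then have "0 \<le> cos t - 1 / 2" by (simp add: cos_60)
    moreover have "((\<lambda>t. sin t - t / 2) has_real_derivative cos t - 1 / 2) (at t)"
      by (auto intro!: derivative_eq_intros)
    ultimately show "\<exists>y. ((\<lambda>t. sin t - t / 2) has_real_derivative y) (at t) \<and> 0 \<le> y" by blast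
  qed
  then have "x / 2 \<le> sin x" by simp
  moreover have "x / pi \<le> x / 2" using assms pi_ge_two by (intro divide_left_mono) auto
  ultimately show ?thesis by linarith
next
  case False
  have "sin (pi / 3) \<le> sin x" using False assms by (intro sin_monotone_2pi_le) auto
  moreover have "x / pi \<le> 1 / 2" using assms by (simp add: field_simps)
  moreover have "1 / 2 \<le> sqrt 3 / 2" by simp
  ultimately show ?thesis unfolding sin_60 by linarith
qed

text \<open>The cosines are the real parts of the powers of a root of unity \<open>z\<close>. As
  \<open>t\<close> stays at distance \<open>W\<close> from the multiples of \<open>p\<close>,
  \<open>cmod (1 - z) \<ge> 2 * W / p\<close>, so the geometric sum is at most
  \<open>p / W \<le> K / 2\<close> in modulus.\<close>

lemma sum_one_minus_cos_ge:
  fixes p W K :: nat and t :: int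
  assumes p: "p > 0" and W: "int W \<le> t mod int p" "t mod int p \<le> int p - int W" "W > 0" and K: "2 * p \<le> K * W"
  shows "real K / 2 \<le> (\<Sum>k=1..K. 1 - cos (2 * pi * (real k * of_int t) / p))"
proof -
  define s where "s = t mod int p"
  define x where "x = pi * of_int s / p"
  define z where "z = cis (2 * x)"
  have "sin x \<ge> W / p"
  proof (cases "x \<le> pi / 2")
    case True
    have "W / p \<le> of_int s / p" using W by (intro divide_right_mono) (simp_all add: s_def)
    also have "\<dots> = x / pi" by (simp add: x_def)
    also have "\<dots> \<le> sin x" using True p by (intro divide_pi_le_sin) (auto simp: x_def s_def)
    finally show ?thesis .
  next
    case False
    have "W / p \<le> of_int (p - s) / p" using W by (intro divide_right_mono) (simp_all add: s_def)
    also have "\<dots> = (pi - x) / pi" using p by (simp add: x_def field_simps)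
    also have "\<dots> \<le> sin (pi - x)"
    proof (rule divide_pi_le_sin)
      have "of_int s \<le> real p" using W by (simp add: s_def)
      then have "x \<le> pi" using p by (simp add: x_def field_simps)
      then show "0 \<le> pi - x" by simp
      show "pi - x \<le> pi / 2" using False by (simp add: field_simps)
    qed
    finally show ?thesis by simp
  qed
  moreover have "cmod (1 - z) = 2 * \<bar>sin x\<bar>"
  proof -
    have "(cmod (1 - z))\<^sup>2 = (1 - cos (2 * x))\<^sup>2 + (sin (2 * x))\<^sup>2"
      by (simp add: z_def cmod_power2)
    also have "\<dots> = 4 * (sin x)\<^sup>2 * ((sin x)\<^sup>2 + (cos x)\<^sup>2)"
    proof -
      have "(1 - (1 - 2 * a\<^sup>2))\<^sup>2 + (2 * a * b)\<^sup>2 = 4 * a\<^sup>2 * (a\<^sup>2 + b\<^sup>2)" for a b :: real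
        by (simp add: power2_eq_square algebra_simps)
      then show ?thesis unfolding cos_double_sin sin_double .
    qed
    also have "\<dots> = (2 * \<bar>sin x\<bar>)\<^sup>2" by (simp add: power_mult_distrib)
    finally show ?thesis by (rule power2_eq_imp_eq) auto
  qed
  ultimately have z1: "2 * W / p \<le> cmod (1 - z)" by simp
  have "(1 - z) * (\<Sum>k=1..K. z ^ k) = z - z ^ Suc K"
  proof (induction K)
    case (Suc K)
    then show ?case by (simp add: distrib_left) (simp add: algebra_simps)
  qed simp
  then have "cmod (1 - z) * cmod (\<Sum>k=1..K. z ^ k) = cmod (z - z ^ Suc K)"
    by (metis norm_mult)
  also have "\<dots> \<le> cmod z + cmod (z ^ Suc K)" by (rule norm_triangle_ineq4)
  also have "\<dots> \<le> 2" by (simp add: z_def norm_power norm_mult)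
  finally have "(2 * W / p) * cmod (\<Sum>k=1..K. z ^ k) \<le> 2"
    using z1 by (meson mult_right_mono norm_ge_zero order_trans)
  then have "W * cmod (\<Sum>k=1..K. z ^ k) \<le> p" using p by (simp add: field_simps)
  also have "real p \<le> W * (K / 2)"
  proof -
    have "real (2 * p) \<le> real (K * W)" using K by (simp only: of_nat_le_iff)
    then show ?thesis by (simp add: mult_ac)
  qed
  finally have "cmod (\<Sum>k=1..K. z ^ k) \<le> K / 2" using W by simp
  then have "Re (\<Sum>k=1..K. z ^ k) \<le> K / 2" using complex_Re_le_cmod order_trans by blast
  also have "Re (\<Sum>k=1..K. z ^ k) = (\<Sum>k=1..K. cos (2 * pi * (real k * of_int t) / p))"
    unfolding Re_sum
  proof (intro sum.cong refl)
    fix k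
    have t: "t = s + int p * (t div int p)" by (simp add: s_def)
    have "2 * pi * (real k * of_int t) / p = real k * (2 * x) + 2 * pi * of_int (int k * (t div int p))"
      using p by (subst t) (simp add: x_def field_simps)
    then have "cos (2 * pi * (real k * of_int t) / p) = cos (real k * (2 * x))"
      by (simp only: cos_add cos_int_2pin sin_int_2pin)
    then show "Re (z ^ k) = cos (2 * pi * (real k * of_int t) / p)"
      by (simp add: z_def DeMoivre)
  qed
  finally show ?thesis by (simp add: sum_subtractf)
qed

section \<open>Characters and Parseval's identity\<close>

context mod_vectors
begin

definition chi :: "('c \<Rightarrow> int) \<Rightarrow> ('c \<Rightarrow> int) \<Rightarrow> complex" where
  "chi l x = cis (2 * pi * of_int (dot l x) / p)"

lemma chi_add: "chi l (\<lambda>c. x c + y c) = chi l x * chi l y"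
  by (simp add: chi_def dot_add cis_mult add_divide_distrib distrib_left)

lemma chi_diff: "chi l (\<lambda>c. x c - y c) = chi l x * cnj (chi l y)"
  by (simp add: chi_def dot_diff cis_cnj cis_mult diff_divide_distrib right_diff_distrib)

text \<open>Orthogonality: the sum factors over the coordinates into sums of roots of unity.\<close>

lemma sum_chi: "(\<Sum>l\<in>V. chi l x) = (if \<forall>c\<in>D. int p dvd x c then of_nat (card V) else 0)"
proof -
  have "chi l x = (\<Prod>c\<in>D. cis (2 * pi * of_int (l c * x c) / p))" for l
  proof -
    have "(\<Prod>c\<in>D. cis (2 * pi * of_int (l c * x c) / p)) = cis (\<Sum>c\<in>D. 2 * pi * of_int (l c * x c) / p)"
      using finite_D by (induction D rule: finite_induct) (simp_all add: cis_mult)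
    then show ?thesis
      by (simp add: chi_def dot_def sum_distrib_left sum_divide_distrib)
  qed
  then have "(\<Sum>l\<in>V. chi l x) = (\<Prod>c\<in>D. \<Sum>t\<in>{0..<int p}. cis (2 * pi * of_int (t * x c) / p))"
    unfolding V_def using finite_D by (subst prod_sum_PiE) auto
  also have "\<dots> = (\<Prod>c\<in>D. if int p dvd x c then of_nat p else 0)"
    by (intro prod.cong refl sum_cis_roots_of_unity p_pos)
  also have "\<dots> = (if \<forall>c\<in>D. int p dvd x c then of_nat (card V) else 0)"
    using finite_D by (auto simp: card_V)
  finally show ?thesis .
qed

text \<open>The squared modulus of the Fourier coefficient at \<open>l\<close> of the indicator
  function of \<open>Y\<close>.\<close>

definition energy :: "('c \<Rightarrow> int) set \<Rightarrow> ('c \<Rightarrow> int) \<Rightarrow> real" where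
  "energy Y l = (cmod (\<Sum>y\<in>Y. chi l y))\<^sup>2"

lemma energy_nonneg: "energy Y l \<ge> 0" by (simp add: energy_def)

text \<open>Expanding the square gives characters at \<open>y + v - y'\<close> for all pairs in
  \<open>Y\<close>; orthogonality retains the pairs with \<open>y' = shift v y\<close>. Real parts
  turn \<open>chi\<close> into cosines.\<close>

lemma sum_energy_cos:
  assumes "Y \<subseteq> V"
  shows "(\<Sum>l\<in>V. energy Y l * cos (2 * pi * of_int (dot l v) / p)) = real (card V) * real (card {y \<in> Y. shift v y \<in> Y})"
proof -
  have fin: "finite Y" using assms finite_V by (rule finite_subset)
  have "(\<Sum>l\<in>V. of_real (energy Y l) * chi l v) = (\<Sum>l\<in>V. \<Sum>y\<in>Y. \<Sum>y'\<in>Y. chi l (\<lambda>c. (y c + v c) - y' c))"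
    unfolding chi_add chi_diff energy_def complex_norm_square cnj_sum sum_distrib_right
    by (simp add: sum_distrib_left mult_ac)
  also have "\<dots> = (\<Sum>y\<in>Y. \<Sum>l\<in>V. \<Sum>y'\<in>Y. chi l (\<lambda>c. (y c + v c) - y' c))"
    by (rule sum.swap)
  also have "\<dots> = (\<Sum>y\<in>Y. \<Sum>y'\<in>Y. \<Sum>l\<in>V. chi l (\<lambda>c. (y c + v c) - y' c))"
    by (intro sum.cong refl sum.swap)
  also have "\<dots> = (\<Sum>y\<in>Y. if shift v y \<in> Y then of_nat (card V) else 0)"
  proof (intro sum.cong refl)
    fix y
    have "(\<forall>c\<in>D. int p dvd (y c + v c) - y' c) \<longleftrightarrow> shift v y = y'" if "y' \<in> Y" for y'
    proof -
      have "red y' = y'" using that assms by (intro red_V) auto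
      then show ?thesis
        using red_eq_iff[of "\<lambda>c. y c + v c" y'] by (simp add: shift_def cong_iff_dvd_diff)
    qed
    then have "(\<Sum>y'\<in>Y. \<Sum>l\<in>V. chi l (\<lambda>c. (y c + v c) - y' c)) =
        (\<Sum>y'\<in>Y. if shift v y = y' then of_nat (card V) else 0)"
      by (intro sum.cong refl) (simp add: sum_chi)
    then show "(\<Sum>y'\<in>Y. \<Sum>l\<in>V. chi l (\<lambda>c. (y c + v c) - y' c)) =
        (if shift v y \<in> Y then of_nat (card V) else 0)"
      using fin by simp
  qed
  also have "\<dots> = of_nat (card V) * of_nat (card {y \<in> Y. shift v y \<in> Y})"
    using fin by (simp add: sum.If_cases Int_def mult.commute)
  finally have "Re (\<Sum>l\<in>V. of_real (energy Y l) * chi l v) =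
      Re (of_nat (card V) * of_nat (card {y \<in> Y. shift v y \<in> Y}))" by simp
  then show ?thesis by (simp add: chi_def)
qed

lemma sum_energy: "Y \<subseteq> V \<Longrightarrow> (\<Sum>l\<in>V. energy Y l) = real (card V) * real (card Y)"
proof -
  assume Y: "Y \<subseteq> V"
  have "{y \<in> Y. shift (\<lambda>_. 0) y \<in> Y} = Y" using Y by (auto simp: shift_zero subset_iff)
  moreover have "dot l (\<lambda>_. 0) = 0" for l by (simp add: dot_def)
  ultimately show ?thesis using sum_energy_cos[OF Y, of "\<lambda>_. 0"] by simp
qed

text \<open>The correlation of \<open>Y\<close> at \<open>0\<close> minus the one at
  \<open>v\<close>. Lower bounds for \<open>1 - cos\<close> thus become lower bounds for the
  leak.\<close>

lemma sum_energy_leak: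
  assumes "Y \<subseteq> V"
  shows "(\<Sum>l\<in>V. energy Y l * (1 - cos (2 * pi * of_int (dot l v) / p))) = real (card V) * real (leak Y v)"
proof -
  have "finite Y" using assms finite_V by (rule finite_subset)
  then have "real (card {y \<in> Y. shift v y \<in> Y}) + real (leak Y v) = real (card Y)"
    using card_stay[of Y v] by (simp flip: of_nat_add)
  then show ?thesis
    using sum_energy[OF assms] sum_energy_cos[OF assms, of v]
    by (simp add: right_diff_distrib sum_subtractf flip: distrib_left) (simp add: algebra_simps flip: distrib_left)
qed

text \<open>The exceptional terms lie on \<open>2 * W\<close> parallel hyperplanes around
  \<open>g i\<close>, and richness bounds the number of terms on each.\<close>

lemma card_near_le:
  assumes R: "finite R" "rich R g h" and l: "l \<in> V" "\<exists>c\<in>D. l c \<noteq> 0"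
  shows "card {j \<in> R. \<not> (int W \<le> dot l (\<lambda>c. g j c - g i c) mod int p \<and>
      dot l (\<lambda>c. g j c - g i c) mod int p \<le> int p - int W)} \<le> 2 * W * h"
proof -
  define t where "t j = dot l (\<lambda>c. g j c - g i c)" for j
  have "\<exists>a\<in>{-int W..<int W}. [dot l (g j) = dot l (g i) + a] (mod int p)"
    if far: "\<not> (int W \<le> t j mod int p \<and> t j mod int p \<le> int p - int W)" for j
  proof -
    define s where "s = t j mod int p"
    have s: "0 \<le> s" "s < int p" using p_pos by (simp_all add: s_def)
    have ts: "[t j = s] (mod int p)" by (simp add: s_def cong_def)
    consider "s < int W" | "s > int p - int W" using far by (auto simp: s_def)
    then obtain a where a: "a \<in> {-int W..<int W}" "[t j = a] (mod int p)"
    proof cases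
      case 1
      then show ?thesis using s ts by (intro that[of s]) auto
    next
      case 2
      have "[t j = s - int p] (mod int p)" using ts by (simp add: cong_def)
      then show ?thesis using 2 s by (intro that[of "s - int p"]) auto
    qed
    then show ?thesis by (auto simp: t_def dot_diff cong_iff_dvd_diff algebra_simps)
  qed
  then have "{j \<in> R. \<not> (int W \<le> t j mod int p \<and> t j mod int p \<le> int p - int W)} \<subseteq>
      (\<Union>a\<in>{-int W..<int W}. {j \<in> R. [dot l (g j) = dot l (g i) + a] (mod int p)})" by blast
  then have "card {j \<in> R. \<not> (int W \<le> t j mod int p \<and> t j mod int p \<le> int p - int W)} \<le>
      card (\<Union>a\<in>{-int W..<int W}. {j \<in> R. [dot l (g j) = dot l (g i) + a] (mod int p)})"
    using R(1) by (intro card_mono) auto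
  also have "\<dots> \<le> (\<Sum>a\<in>{-int W..<int W}. card {j \<in> R. [dot l (g j) = dot l (g i) + a] (mod int p)})"
    by (intro card_UN_le) auto
  also have "\<dots> \<le> (\<Sum>a\<in>{-int W..<int W}. h)"
    using R(2) l unfolding rich_def by (intro sum_mono less_imp_le) auto
  also have "\<dots> = 2 * W * h" by (simp add: nat_mult_distrib)
  finally show ?thesis by (simp add: t_def)
qed

text \<open>Each nontrivial character takes values far from \<open>1\<close> on most of the multiples
  \<open>k (g j - g i)\<close> with \<open>k \<le> K\<close>, so by Parseval one of them moves a constant proportion of \<open>Y\<close>;
  by subadditivity \<open>g j - g i\<close> itself moves the proportion divided by \<open>K\<close>.\<close>

lemma leak_fourier:
  assumes R: "finite R" "rich R g h" "4 * W * h \<le> card R"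
    and W: "W > 0" "2 * p \<le> K * W"
    and Y: "Y \<subseteq> V" "2 * card Y \<le> card V" and i: "i \<in> R"
  shows "\<exists>j\<in>R. card Y \<le> 8 * K * leak Y (\<lambda>c. g j c - g i c)"
proof (rule ccontr)
  assume "\<not> ?thesis"
  then have small: "\<And>j. j \<in> R \<Longrightarrow> 8 * K * leak Y (\<lambda>c. g j c - g i c) < card Y"
    by (simp add: not_le)
  define v where "v j = (\<lambda>c. g j c - g i c)" for j
  define N where "N = real (card R)"
  have fin: "finite Y" using Y finite_V by (auto intro: finite_subset)
  have K: "K > 0" using W p_pos by (cases K) auto
  have V: "card V > 0" using p_pos by (simp add: card_V)
  have N: "N > 0" using R(1) i by (auto simp: N_def card_gt_0_iff)
  \<comment> \<open>The trivial character, for which \<open>1 - cos\<close> vanishes.\<close>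
  define z where "z = (\<lambda>c\<in>D. 0 :: int)"
  have z: "z \<in> V" using p_pos by (auto simp: z_def V_def)
  have Ez: "energy Y z = (real (card Y))\<^sup>2"
    by (simp add: energy_def chi_def dot_def z_def)
  have gain: "N * K / 4 \<le> (\<Sum>j\<in>R. \<Sum>k=1..K. 1 - cos (2 * pi * of_int (dot l (\<lambda>c. int k * v j c)) / p))"
    if l: "l \<in> V - {z}" for l
  proof -
    have "\<exists>c\<in>D. l c \<noteq> 0"
    proof (rule ccontr)
      assume "\<not> ?thesis"
      then have "l = z" using l by (auto simp: z_def V_def PiE_iff extensional_def)
      then show False using l by simp
    qed
    \<comment> \<open>By \<open>card_near_le\<close> and \<open>4 * W * h \<le> card R\<close>, at
      least half of the terms belong to \<open>G\<close>.\<close>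
    define G where "G = {j \<in> R. int W \<le> dot l (v j) mod int p \<and> dot l (v j) mod int p \<le> int p - int W}"
    have "card (R - G) \<le> 2 * W * h"
      using card_near_le[OF R(1,2) _ \<open>\<exists>c\<in>D. l c \<noteq> 0\<close>, of W i] l
      by (simp add: G_def v_def set_diff_eq) (smt (verit) Collect_cong)
    then have "card R \<le> 2 * card G"
      using R(3) R(1) card_Diff_subset[of G R] by (auto simp: G_def)
    then have "N / 2 \<le> card G" by (simp add: N_def)
    then have "N * K / 4 \<le> (\<Sum>j\<in>G. K / 2)" using K by (simp add: field_simps)
    also have "\<dots> \<le> (\<Sum>j\<in>G. \<Sum>k=1..K. 1 - cos (2 * pi * of_int (dot l (\<lambda>c. int k * v j c)) / p))"
    proof (intro sum_mono)
      fix j assume "j \<in> G"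
      then show "real K / 2 \<le> (\<Sum>k=1..K. 1 - cos (2 * pi * of_int (dot l (\<lambda>c. int k * v j c)) / p))"
        using sum_one_minus_cos_ge[of p W "dot l (v j)" K] p_pos W by (simp add: G_def dot_scale)
    qed
    also have "\<dots> \<le> (\<Sum>j\<in>R. \<Sum>k=1..K. 1 - cos (2 * pi * of_int (dot l (\<lambda>c. int k * v j c)) / p))"
      using R(1) by (intro sum_mono2 sum_nonneg) (auto simp: G_def)
    finally show ?thesis .
  qed
  \<comment> \<open>Since \<open>2 * card Y \<le> card V\<close>, the trivial character carries at
    most half of the total energy \<open>card V * card Y\<close>.\<close>
  have "card V * (real (card Y) * (N * K)) / 8 \<le> (card V * real (card Y) - (real (card Y))\<^sup>2) * (N * K / 4)"
  proof -
    have "2 * real (card Y) \<le> card V" using Y(2) by linarith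
    then have "2 * (real (card Y))\<^sup>2 \<le> card V * real (card Y)"
      using mult_right_mono[of "2 * real (card Y)" "card V" "card Y"] by (simp add: power2_eq_square)
    then have "card V * real (card Y) / 2 * (N * K / 4) \<le> (card V * real (card Y) - (real (card Y))\<^sup>2) * (N * K / 4)"
      using N by (intro mult_right_mono) (auto simp: mult.commute)
    then show ?thesis by (simp add: mult_ac)
  qed
  also have "card V * real (card Y) - (real (card Y))\<^sup>2 = (\<Sum>l\<in>V - {z}. energy Y l)"
    using z sum_energy[OF Y(1)] Ez finite_V by (simp add: sum_diff1)
  also have "\<dots> * (N * K / 4) = (\<Sum>l\<in>V - {z}. energy Y l * (N * K / 4))"
    by (rule sum_distrib_right)
  also have "\<dots> \<le> (\<Sum>l\<in>V - {z}. energy Y l * (\<Sum>j\<in>R. \<Sum>k=1..K. 1 - cos (2 * pi * of_int (dot l (\<lambda>c. int k * v j c)) / p)))"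
    using gain by (intro sum_mono mult_left_mono energy_nonneg)
  also have "\<dots> \<le> (\<Sum>l\<in>V. energy Y l * (\<Sum>j\<in>R. \<Sum>k=1..K. 1 - cos (2 * pi * of_int (dot l (\<lambda>c. int k * v j c)) / p)))"
    using finite_V by (intro sum_mono2 mult_nonneg_nonneg energy_nonneg sum_nonneg) auto
  also have "\<dots> = (\<Sum>j\<in>R. \<Sum>k=1..K. \<Sum>l\<in>V. energy Y l * (1 - cos (2 * pi * of_int (dot l (\<lambda>c. int k * v j c)) / p)))"
    unfolding sum_distrib_left by (subst sum.swap, intro sum.cong refl, rule sum.swap)
  also have "\<dots> = (\<Sum>j\<in>R. \<Sum>k=1..K. card V * real (leak Y (\<lambda>c. int k * v j c)))"
    by (simp only: sum_energy_leak[OF Y(1)])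
  \<comment> \<open>The assumed small leaks enter here: with \<open>k \<le> K\<close>, subadditivity
    keeps each leak below \<open>card Y / 8\<close>.\<close>
  also have "\<dots> < (\<Sum>j\<in>R. \<Sum>k=1..K. card V * real (card Y) / 8)"
  proof (intro sum_strict_mono)
    fix j k assume j: "j \<in> R" and k: "k \<in> {1..K}"
    have "8 * leak Y (\<lambda>c. int k * v j c) \<le> 8 * (k * leak Y (v j))" using leak_mult[OF Y(1)] by simp
    also have "\<dots> \<le> 8 * K * leak Y (v j)" using k by (simp add: mult_right_mono)
    also have "\<dots> < card Y" using small[OF j] by (simp add: v_def)
    finally have "8 * real (leak Y (\<lambda>c. int k * v j c)) < card Y" by linarith
    then show "card V * real (leak Y (\<lambda>c. int k * v j c)) < card V * real (card Y) / 8"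
      using V by simp
  qed (use R(1) i K in auto)
  also have "\<dots> = card V * (real (card Y) * (N * K)) / 8" by (simp add: N_def)
  finally show False by simp
qed

end

section \<open>A linear bound for short zero-sum subsequences\<close>

text \<open>Bounds the growth required of one round in \<open>reach_box\<close>. The inner induction
  carries \<open>2 ^ Suc n - 1\<close>, for which its step closes.\<close>

lemma Suc_power_le:
  fixes k :: real
  assumes "1 \<le> k" "0 < d"
  shows "(k + 1) ^ d \<le> k ^ d + 2 ^ d * k ^ (d - 1)"
proof -
  have "(k + 1) ^ Suc n \<le> k ^ Suc n + (2 ^ Suc n - 1) * k ^ n" for n
  proof (induction n)
    case (Suc n)
    have "(k + 1) ^ Suc (Suc n) \<le> (k + 1) * (k ^ Suc n + (2 ^ Suc n - 1) * k ^ n)"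
      using Suc.IH assms by (simp add: mult_left_mono)
    also have "\<dots> = k ^ Suc (Suc n) + 2 ^ Suc n * k ^ Suc n + (2 ^ Suc n - 1) * k ^ n"
      by (simp add: algebra_simps)
    also have "(2 ^ Suc n - 1) * k ^ n \<le> (2 ^ Suc n - 1) * k ^ Suc n"
      using assms one_le_power[of "2 :: real" "Suc n"] by (intro mult_left_mono power_increasing) auto
    finally show ?case by (simp add: algebra_simps)
  qed simp
  from this[of "d - 1"] have "(k + 1) ^ d \<le> k ^ d + (2 ^ d - 1) * k ^ (d - 1)"
    using assms by simp
  also have "(2 ^ d - 1) * k ^ (d - 1) \<le> 2 ^ d * k ^ (d - 1)"
    using assms by (intro mult_right_mono) auto
  finally show ?thesis by simp
qed

section \<open>Growth of the sets of sums of half of the chosen terms\<close>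

context mod_vectors
begin

text \<open>The number of summands is fixed so that the final zero sum has exactly \<open>p\<close>
  terms.\<close>

definition nsums :: "('i \<Rightarrow> 'c \<Rightarrow> int) \<Rightarrow> 'i set \<Rightarrow> nat \<Rightarrow> ('c \<Rightarrow> int) set" where
  "nsums g U n = (\<lambda>I. red (\<lambda>c. \<Sum>i\<in>I. g i c)) ` {I. I \<subseteq> U \<and> card I = n}"

lemma nsums_subset_V: "nsums g U n \<subseteq> V"
  by (auto simp: nsums_def)

lemma finite_nsums: "finite (nsums g U n)"
  using nsums_subset_V finite_V by (rule finite_subset)

lemma nsums_I: "\<lbrakk>I \<subseteq> U; card I = n\<rbrakk> \<Longrightarrow> red (\<lambda>c. \<Sum>i\<in>I. g i c) \<in> nsums g U n"
  by (auto simp: nsums_def)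

text \<open>An \<open>n\<close>-subset of \<open>U\<close> can be completed by \<open>i\<close> or
  by \<open>j\<close>. Up to the translation by \<open>g i\<close>, the new sums contain the old set
  \<open>Y\<close> and its translate by \<open>g j - g i\<close>.\<close>

lemma card_nsums_insert_pair:
  assumes U: "finite U" "i \<notin> U" "j \<notin> U"
  shows "card (nsums g U n) + leak (nsums g U n) (\<lambda>c. g j c - g i c) \<le>
    card (nsums g (insert i (insert j U)) (Suc n))"
proof -
  define Y where "Y = nsums g U n"
  define v where "v = (\<lambda>c. g j c - g i c)"
  have Y: "Y \<subseteq> V" by (simp add: Y_def nsums_subset_V)
  have ins: "shift (g x) y \<in> nsums g (insert i (insert j U)) (Suc n)"
    if x: "x = i \<or> x = j" and "y \<in> Y" for x y
  proof -
    obtain I where I: "I \<subseteq> U" "card I = n" "y = red (\<lambda>c. \<Sum>i\<in>I. g i c)"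
      using \<open>y \<in> Y\<close> by (auto simp: Y_def nsums_def)
    have I': "finite I" "x \<notin> I" using I(1) U x by (auto intro: finite_subset)
    then have "shift (g x) y = red (\<lambda>c. \<Sum>i\<in>insert x I. g i c)"
      unfolding I shift_def red_add_red by (simp add: add.commute)
    moreover have "insert x I \<subseteq> insert i (insert j U)" "card (insert x I) = Suc n"
      using I(1,2) I' x by auto
    ultimately show ?thesis by (simp only: nsums_I)
  qed
  have "shift (g i) (shift v y) = shift (g j) y" for y
    by (simp add: shift_shift v_def)
  then have "shift (g i) ` (Y \<union> shift v ` Y) \<subseteq> nsums g (insert i (insert j U)) (Suc n)"
    using ins by auto
  then have "card (shift (g i) ` (Y \<union> shift v ` Y)) \<le> card (nsums g (insert i (insert j U)) (Suc n))"
    by (intro card_mono finite_nsums)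
  also have "card (shift (g i) ` (Y \<union> shift v ` Y)) = card (Y \<union> shift v ` Y)"
    using Y by (intro card_image inj_on_subset[OF inj_on_shift]) auto
  also have "\<dots> = card Y + leak Y v" using Y by (rule card_union_shift)
  finally show ?thesis by (simp add: Y_def v_def)
qed

definition reach :: "'i set \<Rightarrow> ('i \<Rightarrow> 'c \<Rightarrow> int) \<Rightarrow> nat \<Rightarrow> real \<Rightarrow> bool" where
  "reach R g n x \<longleftrightarrow> (\<exists>U\<subseteq>R. card U = 2 * n \<and> x \<le> real (card (nsums g U n)))"

lemma reach_mono: "\<lbrakk>reach R g n x; y \<le> x\<rbrakk> \<Longrightarrow> reach R g n y"
  by (auto simp: reach_def intro: order_trans)

lemma reach_0: "reach R g 0 1"
proof -
  have "nsums g {} 0 = {red (\<lambda>_. 0)}" by (auto simp: nsums_def)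
  then show ?thesis by (auto simp: reach_def intro!: exI[of _ "{}"])
qed

lemma reach_iterate:
  fixes x e T :: real
  assumes R: "finite R" "2 * N \<le> card R" and "0 < e" "reach R g n x" "n + m \<le> N"
    and gain: "\<And>U n. \<lbrakk>U \<subseteq> R; card U = 2 * n; n < N; x \<le> card (nsums g U n); card (nsums g U n) < T\<rbrakk> \<Longrightarrow>
      \<exists>i\<in>R - U. \<exists>j\<in>R - U. e \<le> leak (nsums g U n) (\<lambda>c. g j c - g i c)"
  shows "reach R g (n + m) (min T (x + m * e))"
  using \<open>n + m \<le> N\<close>
proof (induction m)
  case 0
  show ?case using assms by (auto intro: reach_mono)
next
  case (Suc m)
  then obtain U where U: "U \<subseteq> R" "card U = 2 * (n + m)"
      "min T (x + m * e) \<le> card (nsums g U (n + m))"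
    by (auto simp: reach_def)
  have fin: "finite U" using U R by (auto intro: finite_subset)
  have "\<exists>i\<in>R - U. \<exists>j\<in>R - U. i \<noteq> j \<and>
      min T (x + Suc m * e) \<le> card (nsums g U (n + m)) + leak (nsums g U (n + m)) (\<lambda>c. g j c - g i c)"
  proof (cases "card (nsums g U (n + m)) < T")
    case True
    have "x \<le> x + m * e" using \<open>0 < e\<close> by simp
    then have le: "x \<le> card (nsums g U (n + m))" "x + m * e \<le> card (nsums g U (n + m))"
      using U(3) True by auto
    then obtain i j where ij: "i \<in> R - U" "j \<in> R - U"
        "e \<le> leak (nsums g U (n + m)) (\<lambda>c. g j c - g i c)"
      using gain[OF U(1,2) _ le(1) True] Suc.prems by auto
    then have "i \<noteq> j" using \<open>0 < e\<close> leak_zero[OF nsums_subset_V, of g U "n + m"] by auto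
    moreover have "min T (x + Suc m * e) \<le> card (nsums g U (n + m)) + leak (nsums g U (n + m)) (\<lambda>c. g j c - g i c)"
      using le(2) ij(3) by (simp add: algebra_simps)
    ultimately show ?thesis using ij by blast
  next
    case False
    have "2 \<le> card (R - U)" using U Suc.prems R fin by (simp add: card_Diff_subset)
    then obtain A where "A \<subseteq> R - U" "card A = 2" by (meson obtain_subset_with_card_n)
    then obtain i j where ij: "i \<in> R - U" "j \<in> R - U" "i \<noteq> j" by (auto simp: card_2_iff)
    then show ?thesis using False by (intro bexI[of _ i] bexI[of _ j]) auto
  qed
  then obtain i j where ij: "i \<in> R - U" "j \<in> R - U" "i \<noteq> j"
      "min T (x + Suc m * e) \<le> card (nsums g U (n + m)) + leak (nsums g U (n + m)) (\<lambda>c. g j c - g i c)"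
    by blast
  define U' where "U' = insert i (insert j U)"
  have "card U' = 2 * (n + Suc m)" "U' \<subseteq> R"
    using ij U fin by (auto simp: U'_def)
  moreover have "card (nsums g U (n + m)) + leak (nsums g U (n + m)) (\<lambda>c. g j c - g i c) \<le> card (nsums g U' (n + Suc m))"
    using card_nsums_insert_pair[of U i j g "n + m"] ij fin by (simp add: U'_def)
  then have "min T (x + Suc m * e) \<le> card (nsums g U' (n + Suc m))" using ij(4) by linarith
  ultimately show ?case unfolding reach_def by blast
qed

lemma rich_subset: "\<lbrakk>rich R g h; S \<subseteq> R; finite R\<rbrakk> \<Longrightarrow> rich S g h"
  unfolding rich_def
proof (intro ballI impI allI)
  fix l a
  assume "\<forall>l\<in>V. (\<exists>c\<in>D. l c \<noteq> 0) \<longrightarrow> (\<forall>a. card {i \<in> R. [dot l (g i) = a] (mod int p)} < h)"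
    and "S \<subseteq> R" "finite R" "l \<in> V" "\<exists>c\<in>D. l c \<noteq> 0"
  then have "card {i \<in> R. [dot l (g i) = a] (mod int p)} < h" by blast
  moreover have "card {i \<in> S. [dot l (g i) = a] (mod int p)} \<le> card {i \<in> R. [dot l (g i) = a] (mod int p)}"
    using \<open>S \<subseteq> R\<close> \<open>finite R\<close> by (intro card_mono) auto
  ultimately show "card {i \<in> S. [dot l (g i) = a] (mod int p)} < h" by linarith
qed

text \<open>Each round of \<open>B\<close> pairs raises the size from \<open>k ^ d / 2\<close> to
  \<open>(k + 1) ^ d / 2\<close>, by \<open>leak_box\<close> with side \<open>k + 1\<close>.\<close>

lemma reach_box:
  assumes R: "finite R" "rich R g h" "h + p \<le> card R" and d: "card D = d" "0 < d"
    and B: "B = 8 * d * 2 ^ d"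
    and k: "1 \<le> k" "2 * (B * k) \<le> p"
  shows "reach R g (B * k) (real k ^ d / 2)"
  using k
proof (induction k rule: nat_induct_at_least)
  case base
  \<comment> \<open>The empty sum already meets the threshold \<open>1\<close>, so the gain
    condition is vacuous and these pairs only fix the count.\<close>
  have "reach R g (0 + B) (min 1 (1 + real B * 1))"
    by (rule reach_iterate[where N = B]) (use R base in \<open>auto intro: reach_0\<close>)
  then show ?case by (auto intro: reach_mono)
next
  case (Suc k)
  define T where "T = (real k + 1) ^ d / 2"
  \<comment> \<open>The guaranteed gain: a set of at least \<open>k ^ d / 2\<close> sums has size at
    most \<open>2 * d * (k + 1)\<close> times its leak, and
    \<open>k + 1 \<le> 2 * k\<close>.\<close>
  define e where "e = real k ^ (d - 1) / (8 * d)"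
  have e: "e > 0" using Suc.hyps d by (simp add: e_def)
  have "reach R g (B * k + B) (min T (real k ^ d / 2 + B * e))"
  proof (rule reach_iterate[where N = "B * Suc k"])
    show "reach R g (B * k) (real k ^ d / 2)" using Suc by simp
  next
    fix U n assume U: "U \<subseteq> R" "card U = 2 * n" "n < B * Suc k"
      and Y: "real k ^ d / 2 \<le> card (nsums g U n)" "card (nsums g U n) < T"
    have fin: "finite U" "finite (R - U)" using U R by (auto intro: finite_subset)
    \<comment> \<open>Fewer than \<open>p\<close> terms are in use, so \<open>h\<close> terms remain
      for \<open>leak_box\<close>.\<close>
    have "2 * n < p" using U Suc.prems by linarith
    then have card: "h \<le> card (R - U)" "0 < card (R - U)"
      using R U fin by (simp_all add: card_Diff_subset)
    then obtain i where i: "i \<in> R - U" by (metis card_gt_0_iff ex_in_conv)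
    have "real (2 * card (nsums g U n)) < real (Suc k ^ d)"
      using Y(2) by (simp add: T_def add.commute)
    then have "2 * card (nsums g U n) \<le> Suc k ^ card D" unfolding d by linarith
    moreover have "0 < B" using B d by simp
    then have "Suc k \<le> B * Suc k" by (cases B) auto
    then have "Suc k \<le> p" using Suc.prems by linarith
    ultimately obtain j where j: "j \<in> R - U"
        "card (nsums g U n) \<le> 2 * card D * Suc k * leak (nsums g U n) (\<lambda>c. g j c - g i c)"
      using leak_box[OF fin(2) rich_subset[OF R(2) _ R(1)] card(1) nsums_subset_V _ _ i] by blast
    define L where "L = real (leak (nsums g U n) (\<lambda>c. g j c - g i c))"
    have "real (card (nsums g U n)) \<le> real (2 * d * Suc k * leak (nsums g U n) (\<lambda>c. g j c - g i c))"
      using j(2) unfolding d by (simp only: of_nat_le_iff)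
    then have "real k ^ d / 2 \<le> 2 * d * (k + 1) * L" using Y(1) by (simp add: L_def algebra_simps)
    also have "\<dots> \<le> 2 * d * (2 * k) * L"
      using mult_left_mono[of "real k + 1" "2 * real k" "2 * d * L"] Suc.hyps
      by (simp add: L_def algebra_simps)
    finally have "real k * real k ^ (d - 1) \<le> real k * (8 * d * L)"
      using d(2) by (simp add: power_eq_if[of _ d] mult_ac)
    then have "real k ^ (d - 1) \<le> 8 * d * L" using Suc.hyps by simp
    then have "e \<le> L" using d(2) by (simp add: e_def field_simps)
    then show "\<exists>i\<in>R - U. \<exists>j\<in>R - U. e \<le> leak (nsums g U n) (\<lambda>c. g j c - g i c)"
      using i j(1) by (auto simp: L_def)
  qed (use R Suc.prems e in auto)
  moreover have "T \<le> real k ^ d / 2 + B * e"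
  proof -
    have "B * e = 2 ^ d * real k ^ (d - 1)" using d by (simp add: e_def B)
    moreover have "0 \<le> 2 ^ d * real k ^ (d - 1)" by simp
    moreover have "(real k + 1) ^ d \<le> real k ^ d + 2 ^ d * real k ^ (d - 1)"
      using Suc.hyps d by (intro Suc_power_le) auto
    ultimately show ?thesis unfolding T_def by linarith
  qed
  ultimately show ?case by (simp add: T_def add.commute)
qed

text \<open>About \<open>p / 4\<close> box steps lead to a proportion of at least \<open>1 / E\<close> of \<open>V\<close>; then each of \<open>8 K E\<close>
  Fourier steps, with \<open>K\<close> about \<open>p / (32 E)\<close>, adds at least \<open>card V / (8 K E)\<close>.\<close>

lemma reach_half:
  assumes R: "finite R" "rich R g h" "4 * W * h + p \<le> card R" and d: "card D = d" "0 < d"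
    and B: "B = 8 * d * 2 ^ d" and E: "E = 2 * (8 * B) ^ d" and W: "W = 128 * E" and p: "32 * E \<le> p"
  shows "\<exists>U\<subseteq>R. \<exists>n. card U = 2 * n \<and> 2 * n \<le> p \<and> card V < 2 * card (nsums g U n)"
proof -
  have Bpos: "B > 0" and Epos: "E > 0" using d by (auto simp: B E)
  have "(8 * B) ^ 1 \<le> (8 * B) ^ d" using Bpos d by (intro power_increasing) auto
  then have BE: "4 * B \<le> p" using p by (simp add: E)
  \<comment> \<open>The \<open>B * k\<close> pairs use at most \<open>p / 2\<close> terms; rounding
    costs at most a factor of \<open>2\<close>.\<close>
  define k where "k = p div (4 * B)"
  have k: "1 \<le> k" "4 * B * k \<le> p" using BE Bpos by (simp_all add: k_def div_greater_zero_iff Suc_le_eq)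
  have "p < 4 * B * (k + 1)" using Bpos unfolding k_def by (metis Suc_eq_plus1 dividend_less_times_div mult_Suc_right add.commute mult_pos_pos zero_less_numeral)
  also have "\<dots> \<le> 4 * B * (2 * k)" using k(1) by (intro mult_left_mono) auto
  finally have k2: "p \<le> 8 * B * k" by simp
  \<comment> \<open>The \<open>8 * K * E\<close> Fourier pairs use at most another
    \<open>p / 2\<close> terms, and \<open>W = 128 * E\<close> provides
    \<open>2 * p \<le> K * W\<close> for \<open>leak_fourier\<close>.\<close>
  define K where "K = p div (32 * E)"
  have K: "1 \<le> K" "32 * E * K \<le> p" using p Epos by (simp_all add: K_def div_greater_zero_iff Suc_le_eq)
  have "p < 32 * E * (K + 1)" using Epos unfolding K_def by (metis Suc_eq_plus1 dividend_less_times_div mult_Suc_right add.commute mult_pos_pos zero_less_numeral)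
  also have "\<dots> \<le> 32 * E * (2 * K)" using K(1) by (intro mult_left_mono) auto
  finally have K2: "2 * p \<le> K * W" by (simp add: W)
  have W1: "W > 0" using Epos by (simp add: W)
  have "1 * h \<le> 4 * W * h" using W1 by (intro mult_right_mono) auto
  then have hR: "h + p \<le> card R" using R(3) by linarith
  define x where "x = real k ^ d / 2"
  define e where "e = x / (8 * K)"
  \<comment> \<open>With the \<open>+ 1\<close>, reaching \<open>T\<close> means containing strictly
    more than half of \<open>V\<close>.\<close>
  define T where "T = (real (card V) + 1) / 2"
  have xpos: "x > 0" using k by (simp add: x_def)
  have epos: "e > 0" using xpos K by (simp add: e_def)
  have "p ^ d \<le> (8 * B * k) ^ d" using k2 by (rule power_mono) simp
  then have "real (p ^ d) \<le> real ((8 * B * k) ^ d)" by (simp only: of_nat_le_iff)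
  \<comment> \<open>The choice of \<open>E\<close> makes \<open>(8 * B * k) ^ d\<close> equal to
    \<open>E * x\<close>.\<close>
  then have xE: "card V \<le> E * x"
    by (simp add: card_V d E x_def power_mult_distrib)
  have "reach R g (B * k + 8 * K * E) (min T (x + (8 * K * E) * e))"
  proof (rule reach_iterate[where N = "B * k + 8 * K * E"])
    show "reach R g (B * k) x"
      unfolding x_def using R hR d B k by (intro reach_box[where h = h]) auto
    have N: "2 * (B * k + 8 * K * E) \<le> p" using k K by (simp add: algebra_simps)
    then show "2 * (B * k + 8 * K * E) \<le> card R" using hR by linarith
    fix U n assume U: "U \<subseteq> R" "card U = 2 * n" "n < B * k + 8 * K * E"
      and Y: "x \<le> card (nsums g U n)" "card (nsums g U n) < T"
    have fin: "finite U" "finite (R - U)" using U R by (auto intro: finite_subset)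
    have "2 * n < 2 * (B * k + 8 * K * E)" using U(3) by simp
    then have "2 * n < p" using N by (rule less_le_trans)
    then have card: "4 * W * h \<le> card (R - U)" "0 < card (R - U)"
      using R U fin by (simp_all add: card_Diff_subset)
    then obtain i where i: "i \<in> R - U" by (metis card_gt_0_iff ex_in_conv)
    have "real (2 * card (nsums g U n)) < real (card V + 1)" using Y(2) by (simp add: T_def)
    then have "2 * card (nsums g U n) \<le> card V" by linarith
    then obtain j where j: "j \<in> R - U"
        "card (nsums g U n) \<le> 8 * K * leak (nsums g U n) (\<lambda>c. g j c - g i c)"
      using leak_fourier[OF fin(2) rich_subset[OF R(2) _ R(1)] card(1) W1 K2 nsums_subset_V _ i] by blast
    have "real (card (nsums g U n)) \<le> real (8 * K * leak (nsums g U n) (\<lambda>c. g j c - g i c))"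
      using j(2) by (simp only: of_nat_le_iff)
    then have "e \<le> leak (nsums g U n) (\<lambda>c. g j c - g i c)"
      using Y(1) K by (simp add: e_def field_simps)
    then show "\<exists>i\<in>R - U. \<exists>j\<in>R - U. e \<le> leak (nsums g U n) (\<lambda>c. g j c - g i c)"
      using i j(1) by auto
  qed (use R epos in auto)
  moreover have "T \<le> x + (8 * K * E) * e"
  proof -
    have eq: "(8 * K * E) * e = E * x" using K by (simp add: e_def field_simps)
    have "card V \<ge> 1" using p_pos by (simp add: card_V)
    then show ?thesis unfolding eq using xE xpos by (simp add: T_def)
  qed
  ultimately have "reach R g (B * k + 8 * K * E) T" by (simp add: min_absorb1)
  then obtain U where "U \<subseteq> R" "card U = 2 * (B * k + 8 * K * E)"
      and TU: "T \<le> card (nsums g U (B * k + 8 * K * E))"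
    by (auto simp: reach_def)
  moreover have "2 * (B * k + 8 * K * E) \<le> p" using k K by (simp add: algebra_simps)
  moreover have "card V < 2 * card (nsums g U (B * k + 8 * K * E))"
  proof -
    have "real (card V + 1) \<le> real (2 * card (nsums g U (B * k + 8 * K * E)))"
      using TU by (simp add: T_def)
    then show ?thesis by linarith
  qed
  ultimately show ?thesis by blast
qed

text \<open>Reflecting one set of sums through the value required for a zero total gives two subsets
  of \<open>V\<close> that are too large to be disjoint. All terms of \<open>A\<close> are used;
  they adjust the number of terms.\<close>

lemma zero_sum_of_halves:
  assumes fin: "finite U1" "finite U2" "finite A" and disj: "U1 \<inter> U2 = {}" "A \<inter> (U1 \<union> U2) = {}"
    and big: "card V < card (nsums g U1 n1) + card (nsums g U2 n2)"
  shows "\<exists>I\<subseteq>U1 \<union> U2 \<union> A. card I = n1 + n2 + card A \<and> sums_to_zero p D g I"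
proof -
  define f where "f y = red (\<lambda>c. - (y c + (\<Sum>i\<in>A. g i c)))" for y
  have f: "inj_on f V"
  proof (rule inj_onI)
    fix x y assume xy: "x \<in> V" "y \<in> V" "f x = f y"
    then have "red x = red y"
      by (auto simp: f_def red_eq_iff cong_iff_dvd_diff dvd_diff_commute)
    then show "x = y" using xy by (simp add: red_V)
  qed
  have "nsums g U2 n2 \<inter> f ` nsums g U1 n1 \<noteq> {}"
  proof
    assume "nsums g U2 n2 \<inter> f ` nsums g U1 n1 = {}"
    then have "card (nsums g U2 n2) + card (f ` nsums g U1 n1) = card (nsums g U2 n2 \<union> f ` nsums g U1 n1)"
      by (subst card_Un_disjoint) (auto simp: finite_nsums)
    also have "\<dots> \<le> card V"
      using finite_V nsums_subset_V by (intro card_mono) (auto simp: f_def)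
    also have "card (f ` nsums g U1 n1) = card (nsums g U1 n1)"
      by (intro card_image inj_on_subset[OF f] nsums_subset_V)
    finally show False using big by simp
  qed
  then obtain I1 I2 where I: "I1 \<subseteq> U1" "card I1 = n1" "I2 \<subseteq> U2" "card I2 = n2"
    and eq: "red (\<lambda>c. \<Sum>i\<in>I2. g i c) = f (red (\<lambda>c. \<Sum>i\<in>I1. g i c))"
    by (auto simp: nsums_def)
  have fI: "finite I1" "finite I2" using I fin by (auto intro: finite_subset)
  have dI: "I1 \<inter> I2 = {}" "(I1 \<union> I2) \<inter> A = {}" using I disj by auto
  have "sums_to_zero p D g (I1 \<union> I2 \<union> A)"
    unfolding sums_to_zero_def
  proof
    fix c assume c: "c \<in> D"
    have "[(\<Sum>i\<in>I2. g i c) = - (red (\<lambda>c. \<Sum>i\<in>I1. g i c) c + (\<Sum>i\<in>A. g i c))] (mod int p)"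
      using eq c by (simp add: f_def red_eq_iff)
    also have "[- (red (\<lambda>c. \<Sum>i\<in>I1. g i c) c + (\<Sum>i\<in>A. g i c)) = - ((\<Sum>i\<in>I1. g i c) + (\<Sum>i\<in>A. g i c))] (mod int p)"
      unfolding cong_minus_minus_iff using c by (intro cong_add) (simp_all add: red_def cong_def)
    finally have "int p dvd (\<Sum>i\<in>I2. g i c) + ((\<Sum>i\<in>I1. g i c) + (\<Sum>i\<in>A. g i c))"
      by (simp add: cong_iff_dvd_diff algebra_simps)
    then show "int p dvd (\<Sum>i\<in>I1 \<union> I2 \<union> A. g i c)"
      using fI fin dI by (simp add: sum.union_disjoint algebra_simps)
  qed
  moreover have "card (I1 \<union> I2 \<union> A) = n1 + n2 + card A"
    using fI fin dI I by (simp add: card_Un_disjoint)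
  moreover have "I1 \<union> I2 \<union> A \<subseteq> U1 \<union> U2 \<union> A" using I by auto
  ultimately show ?thesis by blast
qed

text \<open>\<open>reach_half\<close> is applied to \<open>J\<close> and to \<open>J - U1\<close>,
  and arbitrary terms fill the count \<open>n1 + n2 \<le> p\<close> up to \<open>p\<close>. Each
  half uses at most \<open>p\<close> terms, so \<open>3 * p\<close> leaves room for both and for the
  filling.\<close>

lemma zero_sum_of_rich:
  assumes J: "finite J" "rich J g h" "4 * W * h + 3 * p \<le> card J" and d: "card D = d" "0 < d"
    and B: "B = 8 * d * 2 ^ d" and E: "E = 2 * (8 * B) ^ d" and W: "W = 128 * E" and p: "32 * E \<le> p"
  shows "\<exists>I\<subseteq>J. card I = p \<and> sums_to_zero p D g I"
proof -
  obtain U1 n1 where U1: "U1 \<subseteq> J" "card U1 = 2 * n1" "2 * n1 \<le> p" "card V < 2 * card (nsums g U1 n1)"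
    using reach_half[OF J(1,2) _ d B E W p] J(3) by auto
  have fin1: "finite U1" using U1 J by (auto intro: finite_subset)
  have "4 * W * h + p \<le> card (J - U1)" using U1 fin1 J(3) by (simp add: card_Diff_subset)
  then obtain U2 n2 where U2: "U2 \<subseteq> J - U1" "card U2 = 2 * n2" "2 * n2 \<le> p" "card V < 2 * card (nsums g U2 n2)"
    using reach_half[OF _ rich_subset[OF J(2)] _ d B E W p, of "J - U1"] J(1) by auto
  have fin2: "finite U2" using U2 J by (auto intro: finite_subset)
  have "card (J - (U1 \<union> U2)) = card J - card (U1 \<union> U2)"
    using U1 U2 fin1 fin2 by (intro card_Diff_subset) auto
  moreover have "card (U1 \<union> U2) \<le> 2 * p" using card_Un_le[of U1 U2] U1 U2 by linarith
  ultimately have "p - (n1 + n2) \<le> card (J - (U1 \<union> U2))" using J(3) by linarith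
  then obtain A where A: "A \<subseteq> J - (U1 \<union> U2)" "card A = p - (n1 + n2)"
    by (meson obtain_subset_with_card_n)
  have "\<exists>I\<subseteq>U1 \<union> U2 \<union> A. card I = n1 + n2 + card A \<and> sums_to_zero p D g I"
    using fin1 fin2 U1 U2 A J(1) by (intro zero_sum_of_halves) (auto intro: finite_subset)
  moreover have "n1 + n2 + card A = p" using A U1 U2 by simp
  moreover have "U1 \<union> U2 \<union> A \<subseteq> J" using U1 U2 A by auto
  ultimately show ?thesis by (metis order_trans)
qed

text \<open>The \<open>p\<close> parallel hyperplanes given by one coordinate cover
  \<open>J\<close>, so one of them contains at least \<open>h\<close> terms.\<close>

lemma not_rich_if_p_small:
  assumes J: "finite J" "p * h \<le> card J" and "D \<noteq> {}"
  shows "\<not> rich J g h"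
proof
  assume rich: "rich J g h"
  obtain m where m: "m \<in> D" using \<open>D \<noteq> {}\<close> by auto
  define l where "l = (\<lambda>c\<in>D. if c = m then 1 else 0 :: int)"
  have "l \<in> V" using prime_gt_1_nat[OF prime_p] by (auto simp: l_def V_def)
  moreover have "\<exists>c\<in>D. l c \<noteq> 0" using m by (auto simp: l_def)
  ultimately have less: "card {i \<in> J. [dot l (g i) = a] (mod int p)} < h" for a
    using rich by (auto simp: rich_def)
  have "J \<subseteq> (\<Union>a\<in>{0..<int p}. {i \<in> J. [dot l (g i) = a] (mod int p)})"
  proof
    fix i assume "i \<in> J"
    then show "i \<in> (\<Union>a\<in>{0..<int p}. {i \<in> J. [dot l (g i) = a] (mod int p)})"
      using p_pos by (intro UN_I[of "dot l (g i) mod int p"]) (auto simp: cong_def)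
  qed
  then have "card J \<le> card (\<Union>a\<in>{0..<int p}. {i \<in> J. [dot l (g i) = a] (mod int p)})"
    using J(1) by (intro card_mono) auto
  also have "\<dots> \<le> (\<Sum>a\<in>{0..<int p}. card {i \<in> J. [dot l (g i) = a] (mod int p)})"
    by (intro card_UN_le) auto
  also have "\<dots> < (\<Sum>a\<in>{0..<int p}. h)"
    using less p_pos by (intro sum_strict_mono) auto
  also have "\<dots> = p * h" by simp
  finally show False using J(2) by simp
qed

end

text \<open>If a hyperplane carries \<open>C * p\<close> terms, the induction hypothesis handles
  them with one coordinate deleted, and the hyperplane equation recovers that coordinate. Otherwise
  \<open>zero_sum_of_rich\<close> applies.\<close>

theorem egz_linear_prime:
  "\<exists>C. \<forall>p (D :: 'c set) (g :: 'i \<Rightarrow> 'c \<Rightarrow> int) (J :: 'i set). prime p \<longrightarrow> finite D \<longrightarrow> card D = d \<longrightarrow> finite J \<longrightarrow>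
     C * p \<le> card J \<longrightarrow> (\<exists>I\<subseteq>J. card I = p \<and> sums_to_zero p D g I)"
proof (induction d)
  case 0
  show ?case
    by (rule exI[of _ 1]) (auto simp: sums_to_zero_def intro: obtain_subset_with_card_n)
next
  case (Suc d)
  then obtain C where C: "\<And>p (D :: 'c set) (g :: 'i \<Rightarrow> 'c \<Rightarrow> int) (J :: 'i set). \<lbrakk>prime p; finite D; card D = d; finite J;
     C * p \<le> card J\<rbrakk> \<Longrightarrow> \<exists>I\<subseteq>J. card I = p \<and> sums_to_zero p D g I" by blast
  define B :: nat where "B = 8 * Suc d * 2 ^ Suc d"
  define E where "E = 2 * (8 * B) ^ Suc d"
  define W where "W = 128 * E"
  show ?case
  \<comment> \<open>Times \<open>p\<close> this is \<open>4 * W * h + 3 * p\<close> with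
    \<open>h = C * p\<close>.\<close>
  proof (intro exI[of _ "4 * W * C + 3"] allI impI)
    fix p :: nat and D :: "'c set" and g :: "'i \<Rightarrow> 'c \<Rightarrow> int" and J :: "'i set"
    assume p: "prime p" and D: "finite D" "card D = Suc d" and J: "finite J" "(4 * W * C + 3) * p \<le> card J"
    interpret mod_vectors p D by unfold_locales (use p D in auto)
    show "\<exists>I\<subseteq>J. card I = p \<and> sums_to_zero p D g I"
    proof (cases "rich J g (C * p)")
      case True
      \<comment> \<open>A smaller \<open>p\<close> is at most \<open>W\<close>, so
        \<open>p * (C * p) \<le> card J\<close>, which contradicts richness.\<close>
      have "32 * E \<le> p"
      proof (rule ccontr)
        assume "\<not> 32 * E \<le> p"
        then have "p * (C * p) \<le> W * (C * p)" by (intro mult_right_mono) (auto simp: W_def)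
        also have "\<dots> \<le> card J" using J(2) by (simp add: algebra_simps)
        finally have "p * (C * p) \<le> card J" .
        moreover have "D \<noteq> {}" using D(2) by auto
        ultimately show False using not_rich_if_p_small[OF J(1)] True by blast
      qed
      moreover have "4 * W * (C * p) + 3 * p \<le> card J" using J(2) by (simp add: algebra_simps)
      ultimately show ?thesis
        using zero_sum_of_rich[OF J(1) True _ D(2) _ B_def E_def W_def] by simp
    next
      case False
      then obtain l a where l: "l \<in> V" "\<exists>c\<in>D. l c \<noteq> 0"
        and a: "C * p \<le> card {i \<in> J. [dot l (g i) = a] (mod int p)}"
        by (auto simp: rich_def not_less)
      then obtain m where m: "m \<in> D" "l m \<noteq> 0" by blast
      define J' where "J' = {i \<in> J. [dot l (g i) = a] (mod int p)}"
      have "\<exists>I\<subseteq>J'. card I = p \<and> sums_to_zero p (D - {m}) g I"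
        using p D m J a by (intro C) (auto simp: J'_def)
      then obtain I where I: "I \<subseteq> J'" "card I = p" "sums_to_zero p (D - {m}) g I" by blast
      \<comment> \<open>The \<open>p\<close> chosen terms share the level \<open>a\<close>, so their
        levels sum to \<open>p * a\<close>. The other coordinates vanish modulo \<open>p\<close>,
        and \<open>l m\<close> is invertible.\<close>
      have "int p dvd (\<Sum>i\<in>I. g i m)"
      proof -
        have "[(\<Sum>i\<in>I. dot l (g i)) = (\<Sum>i\<in>I. a)] (mod int p)"
          using I(1) by (intro cong_sum) (auto simp: J'_def)
        then have "int p dvd (\<Sum>i\<in>I. dot l (g i))"
          using I(2) by (simp add: cong_dvd_iff)
        also have "(\<Sum>i\<in>I. dot l (g i)) = (\<Sum>c\<in>D. l c * (\<Sum>i\<in>I. g i c))"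
          unfolding dot_def by (subst sum.swap) (simp add: sum_distrib_left)
        also have "\<dots> = l m * (\<Sum>i\<in>I. g i m) + (\<Sum>c\<in>D - {m}. l c * (\<Sum>i\<in>I. g i c))"
          using D m by (simp add: sum.remove)
        finally have "int p dvd l m * (\<Sum>i\<in>I. g i m) + (\<Sum>c\<in>D - {m}. l c * (\<Sum>i\<in>I. g i c))" .
        moreover have "int p dvd (\<Sum>c\<in>D - {m}. l c * (\<Sum>i\<in>I. g i c))"
        proof (rule dvd_sum)
          fix c assume "c \<in> D - {m}"
          then show "int p dvd l c * (\<Sum>i\<in>I. g i c)"
            using I(3) by (simp add: sums_to_zero_def)
        qed
        ultimately have "int p dvd l m * (\<Sum>i\<in>I. g i m)" by (simp only: dvd_add_left_iff)
        moreover have "0 \<le> l m" "l m < int p" using l(1) m(1) by (auto simp: V_def PiE_iff)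
        then have "\<not> int p dvd l m" using m(2) by (auto dest: zdvd_imp_le)
        ultimately show ?thesis using prime_int_p by (simp add: prime_dvd_mult_iff)
      qed
      then have "sums_to_zero p D g I" using I(3) by (auto simp: sums_to_zero_def)
      then show ?thesis using I by (auto simp: J'_def)
    qed
  qed
qed

text \<open>A bound linear in \<open>m - 1\<close> respects factorization, as
  \<open>p * (n - 1) + (p - 1) = p * n - 1\<close>. Strong induction splits off one prime factor by
  \<open>zero_sum_blocks_mult\<close>.\<close>

theorem short_zero_sum_linear:
  "\<exists>C. \<forall>m (D :: 'c set) (g :: nat \<Rightarrow> 'c \<Rightarrow> int) J. 0 < m \<longrightarrow> finite D \<longrightarrow> card D = d \<longrightarrow> finite J \<longrightarrow>
     C * (m - 1) + 1 \<le> card J \<longrightarrow> (\<exists>I\<subseteq>J. I \<noteq> {} \<and> card I \<le> m \<and> sums_to_zero m D g I)"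
proof -
  obtain C where C: "\<And>p (D :: 'c set) (g :: nat \<Rightarrow> 'c \<Rightarrow> int) (J :: nat set).
      \<lbrakk>prime p; finite D; card D = d; finite J; C * p \<le> card J\<rbrakk> \<Longrightarrow>
      \<exists>I\<subseteq>J. card I = p \<and> sums_to_zero p D g I"
    using egz_linear_prime[of d] by blast
  \<comment> \<open>The prime constant is doubled because
    \<open>p \<le> 2 * (p - 1)\<close>.\<close>
  have "\<exists>I\<subseteq>J. I \<noteq> {} \<and> card I \<le> m \<and> sums_to_zero m D g I"
    if "0 < m" "finite D" "card D = d" "finite J" "2 * C * (m - 1) + 1 \<le> card J"
    for m and D :: "'c set" and g :: "nat \<Rightarrow> 'c \<Rightarrow> int" and J
    using that(1,4,5)
  proof (induction m arbitrary: g J rule: less_induct)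
    case (less m)
    show ?case
    proof (cases "m = 1")
      case True
      then obtain j where "j \<in> J" using less.prems by fastforce
      then show ?thesis using True by (intro exI[of _ "{j}"]) (auto simp: sums_to_zero_def)
    next
      case False
      then obtain p where p: "prime p" "p dvd m" using prime_factor_nat by blast
      then obtain n where m: "m = p * n" by blast
      have n: "0 < n" "n < m" using less.prems(1) prime_gt_1_nat[OF p(1)] by (auto simp: m)
      have "\<exists>I\<subseteq>J. I \<noteq> {} \<and> card I \<le> p \<and> sums_to_zero p D g I"
        if J: "finite J" "2 * C * (p - 1) + 1 \<le> card J" for J
      proof -
        have "p \<le> 2 * (p - 1)" using prime_gt_1_nat[OF p(1)] by simp
        then have "C * p \<le> C * (2 * (p - 1))" by (rule mult_left_mono) simp
        also have "\<dots> \<le> card J" using J(2) by (simp add: mult_ac)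
        finally have "C * p \<le> card J" .
        then obtain I where "I \<subseteq> J" "card I = p" "sums_to_zero p D g I"
          using C[OF p(1) \<open>finite D\<close> \<open>card D = d\<close> J(1)] by blast
        moreover from this have "I \<noteq> {}" using prime_gt_0_nat[OF p(1)] by auto
        ultimately show ?thesis by blast
      qed
      moreover have "\<exists>I\<subseteq>{..<2 * C * (n - 1) + 1}. I \<noteq> {} \<and> card I \<le> n \<and> sums_to_zero n D h I"
        for h :: "nat \<Rightarrow> 'c \<Rightarrow> int"
        using n by (intro less.IH) auto
      moreover have "p * (2 * C * (n - 1) + 1) + (2 * C * (p - 1) + 1) \<le> card J + p"
      proof -
        have "p * (n - 1) + (p - 1) = m - 1"
          using n prime_gt_0_nat[OF p(1)] by (simp add: m diff_mult_distrib2)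
        then have "2 * C * (p * (n - 1) + (p - 1)) + 1 \<le> card J" using less.prems(3) by simp
        then show ?thesis by (simp add: algebra_simps)
      qed
      ultimately show ?thesis
        unfolding m by (intro zero_sum_blocks_mult less.prems(2))
    qed
  qed
  then show ?thesis by blast
qed

section \<open>The Davenport constant\<close>

lemma seq_sum_cyclic_power:
  assumes "0 < n" "finite I" "\<And>i. i \<in> I \<Longrightarrow> x i \<in> carrier (cyclic_power n r)"
  shows "seq_sum (cyclic_power n r) (image_mset x (mset_set I)) = (\<lambda>c\<in>{..<r}. (\<Sum>i\<in>I. x i c) mod int n)"
  using assms(2,3)
proof (induction I rule: finite_induct)
  case empty
  show ?case
    by (simp add: seq_sum_empty[OF comm_group_cyclic_power]) (simp add: cyclic_power_def)
next
  case (insert i I)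
  have "seq_sum (cyclic_power n r) (image_mset x (mset_set (insert i I))) =
      x i \<otimes>\<^bsub>cyclic_power n r\<^esub> seq_sum (cyclic_power n r) (image_mset x (mset_set I))"
    using insert by (simp add: seq_sum_add_mset[OF comm_group_cyclic_power] image_subset_iff)
  also have "\<dots> = x i \<otimes>\<^bsub>cyclic_power n r\<^esub> (\<lambda>c\<in>{..<r}. (\<Sum>i\<in>I. x i c) mod int n)"
    using insert by (simp only: insert_iff simp_thms)
  also have "\<dots> = (\<lambda>c\<in>{..<r}. (\<Sum>i\<in>insert i I. x i c) mod int n)"
    using insert.hyps \<open>0 < n\<close>
    by (auto simp: cyclic_power_def integer_mod_group_def integer_group_def mod_simps)
  finally show ?case .
qed

text \<open>A multiset is enumerated by a list; sets of positions then yield submultisets with the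
  right multiplicities.\<close>

lemma davenport_cyclic_power_le:
  assumes n: "0 < n" and t: "1 \<le> t"
    and zs: "\<And>(g :: nat \<Rightarrow> nat \<Rightarrow> int) J. \<lbrakk>finite J; t \<le> card J\<rbrakk> \<Longrightarrow>
      \<exists>I\<subseteq>J. I \<noteq> {} \<and> sums_to_zero n {..<r} g I"
  shows "davenport (cyclic_power n r) \<le> t"
proof -
  have "\<exists>T. T \<subseteq># S \<and> T \<noteq> {#} \<and> zero_sum (cyclic_power n r) T"
    if S: "set_mset S \<subseteq> carrier (cyclic_power n r)" "t \<le> size S" for S
  proof -
    obtain xs where xs: "mset xs = S" using ex_mset by blast
    define J where "J = {..<length xs}"
    have "t \<le> card J" using S xs by (auto simp: J_def)
    then obtain I where I: "I \<subseteq> J" "I \<noteq> {}" "sums_to_zero n {..<r} (nth xs) I"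
      using zs[of J "nth xs"] by (auto simp: J_def)
    have fin: "finite I" using I(1) by (auto simp: J_def intro: finite_subset)
    have "S = image_mset (nth xs) (mset_set J)"
      by (metis J_def map_nth mset_map mset_set_upto_eq_mset_upto lessThan_atLeast0 atLeast_upt xs)
    moreover have "mset_set I \<subseteq># mset_set J"
      using I(1) by (intro subset_imp_msubset_mset_set) (auto simp: J_def)
    ultimately have "image_mset (nth xs) (mset_set I) \<subseteq># S"
      by (simp add: image_mset_subseteq_mono)
    moreover have "image_mset (nth xs) (mset_set I) \<noteq> {#}"
      using I(2) fin by (simp add: mset_set_empty_iff)
    moreover have "zero_sum (cyclic_power n r) (image_mset (nth xs) (mset_set I))"
    proof -
      have "nth xs i \<in> carrier (cyclic_power n r)" if "i \<in> I" for i
      proof -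
        have "i < length xs" using that I(1) by (auto simp: J_def)
        then show ?thesis using nth_mem S(1) xs by fastforce
      qed
      then have "seq_sum (cyclic_power n r) (image_mset (nth xs) (mset_set I)) =
          (\<lambda>c\<in>{..<r}. (\<Sum>i\<in>I. (xs ! i) c) mod int n)"
        using n fin by (intro seq_sum_cyclic_power) auto
      also have "\<dots> = (\<lambda>c\<in>{..<r}. 0)"
        using I(3) by (intro restrict_ext) (auto simp: sums_to_zero_def)
      also have "\<dots> = \<one>\<^bsub>cyclic_power n r\<^esub>" by (simp add: cyclic_power_def)
      finally show ?thesis by (simp add: zero_sum_def)
    qed
    ultimately show ?thesis by blast
  qed
  then show ?thesis
    unfolding davenport_def using t by (intro Least_le) (auto simp: forces_zero_sum_def)
qed

lemma greatest_primepow_eq: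
  assumes "1 \<le> n"
  shows "\<exists>p k. prime p \<and> greatest_primepow n = p ^ k \<and> p ^ k dvd n"
proof (cases "n = 1")
  \<comment> \<open>The conventional value \<open>1\<close> is written as
    \<open>2 ^ 0\<close>.\<close>
  case True
  then show ?thesis
    by (intro exI[of _ 2] exI[of _ 0]) (auto simp: greatest_primepow_def two_is_prime_nat)
next
  case False
  define Q where "Q = {q. primepow q \<and> q dvd n}"
  have "finite Q" using assms by (auto simp: Q_def)
  moreover obtain p where "prime p" "p dvd n" using False prime_factor_nat by blast
  then have "p \<in> Q" by (simp add: Q_def primepow_prime)
  then have "Q \<noteq> {}" by auto
  ultimately have "Max Q \<in> Q" by (rule Max_in)
  moreover have "greatest_primepow n = Max Q" using False by (simp add: greatest_primepow_def Q_def)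
  ultimately have "primepow (greatest_primepow n)" "greatest_primepow n dvd n"
    by (simp_all add: Q_def)
  then show ?thesis unfolding primepow_def by metis
qed

theorem theorem2:
  fixes r :: nat
  assumes "r \<ge> 1"
  shows "\<exists>d :: real. d \<ge> 0 \<and>
           (\<forall>n :: nat. n \<ge> 1 \<longrightarrow>
              real (davenport (cyclic_power n r))
                \<le> real r * (real n - 1) + 1 + d * (real n / real (greatest_primepow n) - 1))"
proof -
  obtain C where C: "\<And>m (D :: nat set) (g :: nat \<Rightarrow> nat \<Rightarrow> int) J.
      \<lbrakk>0 < m; finite D; card D = r; finite J; C * (m - 1) + 1 \<le> card J\<rbrakk> \<Longrightarrow>
      \<exists>I\<subseteq>J. I \<noteq> {} \<and> card I \<le> m \<and> sums_to_zero m D g I"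
    using short_zero_sum_linear[of r] by blast
  show ?thesis
  \<comment> \<open>The constant for short blocks depends only on \<open>r\<close> and serves as
    \<open>d\<close>.\<close>
  proof (intro exI[of _ "real C"] conjI allI impI)
    fix n :: nat assume n: "1 \<le> n"
    obtain p k where p: "prime p" "greatest_primepow n = p ^ k" "p ^ k dvd n"
      using greatest_primepow_eq[OF n] by blast
    define q where "q = p ^ k"
    have q: "0 < q" using p(1) by (simp add: q_def prime_gt_0_nat)
    obtain m where nm: "n = m * q" using p(3) by (metis dvd_def mult.commute q_def)
    have m: "0 < m" using n by (auto simp: nm)
    \<comment> \<open>Olson's bound for \<open>q\<close>: this many blocks suffice.\<close>
    define t where "t = r * (q - 1) + 1"
    \<comment> \<open>This is \<open>m * (t - 1)\<close> terms for all blocks but the last, plus the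
      \<open>C * (m - 1) + 1\<close> terms that guarantee the last one.\<close>
    have "davenport (cyclic_power n r) \<le> m * (r * (q - 1)) + C * (m - 1) + 1"
    proof (rule davenport_cyclic_power_le)
      fix g :: "nat \<Rightarrow> nat \<Rightarrow> int" and J :: "nat set"
      assume J: "finite J" "m * (r * (q - 1)) + C * (m - 1) + 1 \<le> card J"
      have "\<exists>I \<subseteq> J. I \<noteq> {} \<and> card I \<le> m * t \<and> sums_to_zero (m * q) {..<r} g I"
      proof (rule zero_sum_blocks_mult)
        show "\<exists>I\<subseteq>J. I \<noteq> {} \<and> card I \<le> m \<and> sums_to_zero m {..<r} g I"
          if "finite J" "C * (m - 1) + 1 \<le> card J" for J :: "nat set"
          using that m by (intro C) auto
        show "\<exists>I\<subseteq>{..<t}. I \<noteq> {} \<and> card I \<le> t \<and> sums_to_zero q {..<r} h I" for h :: "nat \<Rightarrow> nat \<Rightarrow> int"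
        proof -
          obtain I where "I \<subseteq> {..<t}" "I \<noteq> {}" "sums_to_zero q {..<r} h I"
            using olson_zero_sum[OF p(1) q_def, of "{..<r}" "{..<t}" h] by (auto simp: t_def)
          moreover from this have "card I \<le> t" using card_mono[of "{..<t}" I] by simp
          ultimately show ?thesis by blast
        qed
        show "m * t + (C * (m - 1) + 1) \<le> card J + m"
          using J(2) by (simp add: t_def algebra_simps)
      qed (use J in auto)
      then show "\<exists>I\<subseteq>J. I \<noteq> {} \<and> sums_to_zero n {..<r} g I" by (auto simp: nm)
    qed (use n in auto)
    then have "real (davenport (cyclic_power n r)) \<le> real (m * (r * (q - 1)) + C * (m - 1) + 1)"
      by (simp only: of_nat_le_iff)
    also have "\<dots> = real r * (real n - real m) + 1 + C * (real m - 1)"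
    proof -
      obtain m' q' where "m = Suc m'" "q = Suc q'" using m q by (metis gr0_conv_Suc)
      then show ?thesis by (simp add: nm algebra_simps)
    qed
    also have "\<dots> \<le> real r * (real n - 1) + 1 + C * (real m - 1)"
      using m by (intro add_mono mult_left_mono) auto
    also have "real m = real n / real (greatest_primepow n)"
    proof -
      have "greatest_primepow n = q" using p(2) by (simp add: q_def)
      then show ?thesis using q by (simp add: nm)
    qed
    finally show "real (davenport (cyclic_power n r))
        \<le> real r * (real n - 1) + 1 + C * (real n / real (greatest_primepow n) - 1)" .
  qed simp
qed

end
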